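(* Let $p\in(0,1/2)$ and let $\nu$ be the probability measure on $\{a,a^{-1},b,b^{-1}\}\subset B_3$ given by $\nu(a)=\nu(b)=p$ and $\nu(a^{-1})=\nu(b^{-1})=1/2-p$. Let $\gamma(p),\gamma_{\Sigma}(p),\gamma_{S_+}(p),\gamma_{\Delta}(p)$ be the drifts of the random walk $(B_3,\nu)$ as defined in the context. Then $$\gamma_{\Sigma}(p)=\frac{-1+\sqrt{16p^2-8p+5}}{4},\qquad \gamma_{S_+}(p)=\frac{4p^2+p+1-3p\sqrt{16p^2-8p+5}}{2(1-4p)},$$ $$\gamma_{\Delta}(p)=-\,\frac{12p^2-5p+1-p\sqrt{16p^2-8p+5}}{2(1-4p)},$$ and $$\gamma(p)=\max\Bigl[\,1-4p,\ \frac{(1-2p)\bigl(-1-4p+\sqrt{5-8p+16p^2}\bigr)}{2(1-4p)},\ \frac{p\bigl(-3+4p+\sqrt{5-8p+16p^2}\bigr)}{-1+4p},\ -1+4p\,\Bigr],$$ where at $p=1/4$ the quotients with vanishing denominator are understood as their limits as $p\to 1/4$.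
   Context: $B_3=\langle a,b\mid aba=bab\rangle$ is the braid group on three strands, $S=\{a,a^{-1},b,b^{-1}\}$, and $|g|_S$ is the word length of $g\in B_3$ with respect to $S$. Put $\Delta=aba=bab$ and $T=\{a,b,ab,ba\}\subset B_3$. Define $\mathrm{First}$ and $\mathrm{Last}$ on $T$ as the first and last letter: $\mathrm{First}(a)=\mathrm{Last}(a)=a$, $\mathrm{First}(b)=\mathrm{Last}(b)=b$, $\mathrm{First}(ab)=a$, $\mathrm{Last}(ab)=b$, $\mathrm{First}(ba)=b$, $\mathrm{Last}(ba)=a$. Every $g\in B_3$ can be written in a unique way as $g=t_1\cdots t_l\Delta^{k}$ with $l\ge 0$, $t_i\in T$, $\mathrm{Last}(t_i)=\mathrm{First}(t_{i+1})$ for $1\le i<l$, and $k\in\mathbb{Z}$ (Garside normal form). Write $\widehat g=t_1\cdots t_l$, let $|\widehat g|_T=l$ be the number of factors in $T$, and let $|\widehat g|_{S_+}$ ($S_+=\{a,b\}$) be the total number of letters $a,b$ in $t_1\cdots t_l$, i.e. the factors $a,b$ count for $1$ and the factors $ab,ba$ count for $2$. For a probability measure $\nu$ on $S$, a realization of the random walk $(B_3,\nu)$ is $X_n=x_1x_2\cdots x_n$, $X_0=1$, with $(x_i)$ i.i.d. of law $\nu$. Write the Garside normal form of $X_n$ as $\widehat X_n\Delta^{k_n}$. The drifts are the almost sure (constant) limits $$\gamma=\lim_n\frac{|X_n|_S}{n},\quad \gamma_{\Sigma}=\lim_n\frac{|\widehat X_n|_T}{n},\quad \gamma_{S_+}=\lim_n\frac{|\widehat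 X_n|_{S_+}}{n},\quad \gamma_{\Delta}=\lim_n\frac{k_n}{n}.$$ *)

theory Defs
  imports "HOL-Algebra.Group" "HOL-Probability.Probability"
begin

text \<open>
  The braid group \<open>B\<^sub>3 = \<langle>a, b | aba = bab\<rangle>\<close>: words in the letters
  \<open>a\<close>, \<open>a\<inverse>\<close>, \<open>b\<close>, \<open>b\<inverse>\<close> modulo the congruence generated by free
  cancellation and the braid relation.
\<close>

datatype letter = La | La_inv | Lb | Lb_inv

fun letter_inv :: "letter \<Rightarrow> letter" where
  "letter_inv La = La_inv"
| "letter_inv La_inv = La"
| "letter_inv Lb = Lb_inv"
| "letter_inv Lb_inv = Lb"

inductive braid_eq :: "letter list \<Rightarrow> letter list \<Rightarrow> bool" where
  braid_eq_refl: "braid_eq u u"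
| braid_eq_sym: "braid_eq u v \<Longrightarrow> braid_eq v u"
| braid_eq_trans: "braid_eq u v \<Longrightarrow> braid_eq v w \<Longrightarrow> braid_eq u w"
| braid_eq_cancel: "braid_eq (u @ [x, letter_inv x] @ v) (u @ v)"
| braid_eq_braid: "braid_eq (u @ [La, Lb, La] @ v) (u @ [Lb, La, Lb] @ v)"

lemma equivp_braid_eq: "equivp braid_eq"
  by (rule equivpI)
    (auto intro!: reflpI sympI transpI intro: braid_eq_refl braid_eq_sym braid_eq_trans)

lemma braid_eq_context: "braid_eq u v \<Longrightarrow> braid_eq (s @ u @ t) (s @ v @ t)"
proof (induction rule: braid_eq.induct)
  case (braid_eq_cancel u x v)
  show ?case using braid_eq.braid_eq_cancel[of "s @ u" x "v @ t"] by simp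
next
  case (braid_eq_braid u v)
  show ?case using braid_eq.braid_eq_braid[of "s @ u" "v @ t"] by simp
qed (auto intro: braid_eq.intros)

lemma braid_eq_append:
  assumes "braid_eq u u'" "braid_eq v v'"
  shows "braid_eq (u @ v) (u' @ v')"
  using braid_eq_context[OF assms(1), of "[]" v] braid_eq_context[OF assms(2), of u' "[]"]
  by (auto intro: braid_eq_trans)

lemma letter_inv_letter_inv [simp]: "letter_inv (letter_inv x) = x"
  by (cases x) auto

lemma braid_eq_inverse: "braid_eq (map letter_inv (rev w) @ w) []"
proof (induction w)
  case Nil
  show ?case by (simp add: braid_eq_refl)
next
  case (Cons x w)
  have "braid_eq (map letter_inv (rev w) @ [letter_inv x, letter_inv (letter_inv x)] @ w)
      (map letter_inv (rev w) @ w)"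
    by (rule braid_eq_cancel)
  with Cons.IH show ?case by (auto intro: braid_eq_trans)
qed

quotient_type braid3 = "letter list" / braid_eq
  by (rule equivp_braid_eq)

lift_definition braid3_mult :: "braid3 \<Rightarrow> braid3 \<Rightarrow> braid3" is append
  by (rule braid_eq_append)

lift_definition braid3_one :: braid3 is "[]" .

definition B3 :: "braid3 monoid" where
  "B3 = \<lparr>carrier = UNIV, monoid.mult = braid3_mult, one = braid3_one\<rparr>"

lemma group_B3: "group B3"
proof (rule groupI)
  fix x assume "x \<in> carrier B3"
  have "\<exists>y. braid3_mult y x = braid3_one"
    by transfer (blast intro: braid_eq_inverse)
  then show "\<exists>y\<in>carrier B3. y \<otimes>\<^bsub>B3\<^esub> x = \<one>\<^bsub>B3\<^esub>"
    by (simp add: B3_def)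
qed (simp_all add: B3_def, (transfer, simp add: braid_eq_refl)+)

lift_definition gen_a :: braid3 is "[La]" .
lift_definition gen_b :: braid3 is "[Lb]" .

definition B3_gens :: "braid3 set" where
  "B3_gens = {gen_a, inv\<^bsub>B3\<^esub> gen_a, gen_b, inv\<^bsub>B3\<^esub> gen_b}"

definition B3_prod :: "braid3 list \<Rightarrow> braid3" where
  "B3_prod gs = foldr (\<lambda>g h. g \<otimes>\<^bsub>B3\<^esub> h) gs \<one>\<^bsub>B3\<^esub>"

definition word_length :: "braid3 \<Rightarrow> nat" where
  "word_length g = (LEAST n. \<exists>gs. length gs = n \<and> set gs \<subseteq> B3_gens \<and> B3_prod gs = g)"


definition garside_Delta :: braid3 where
  "garside_Delta = gen_a \<otimes>\<^bsub>B3\<^esub> gen_b \<otimes>\<^bsub>B3\<^esub> gen_a"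

definition garside_T :: "braid3 set" where
  "garside_T = {gen_a, gen_b, gen_a \<otimes>\<^bsub>B3\<^esub> gen_b, gen_b \<otimes>\<^bsub>B3\<^esub> gen_a}"

text \<open>The following three functions are meaningful on \<^const>\<open>garside_T\<close> only.\<close>

definition First :: "braid3 \<Rightarrow> braid3" where
  "First t = (if t \<in> {gen_a, gen_a \<otimes>\<^bsub>B3\<^esub> gen_b} then gen_a else gen_b)"

definition Last :: "braid3 \<Rightarrow> braid3" where
  "Last t = (if t \<in> {gen_a, gen_b \<otimes>\<^bsub>B3\<^esub> gen_a} then gen_a else gen_b)"

definition letter_count :: "braid3 \<Rightarrow> nat" where
  "letter_count t = (if t \<in> {gen_a, gen_b} then 1 else 2)"

definition is_garside_form :: "braid3 \<Rightarrow> braid3 list \<Rightarrow> int \<Rightarrow> bool" where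
  "is_garside_form g ts k \<longleftrightarrow>
     set ts \<subseteq> garside_T \<and>
     (\<forall>i. Suc i < length ts \<longrightarrow> Last (ts ! i) = First (ts ! Suc i)) \<and>
     g = B3_prod ts \<otimes>\<^bsub>B3\<^esub> (garside_Delta [^]\<^bsub>B3\<^esub> k)"

text \<open>The description is proper because every element has exactly one Garside normal form.\<close>

definition garside_form :: "braid3 \<Rightarrow> braid3 list \<times> int" where
  "garside_form g = (THE (ts, k). is_garside_form g ts k)"

definition garside_length_T :: "braid3 \<Rightarrow> nat" where
  "garside_length_T g = length (fst (garside_form g))"

definition garside_length_pos :: "braid3 \<Rightarrow> nat" where
  "garside_length_pos g = sum_list (map letter_count (fst (garside_form g)))"

definition garside_exponent :: "braid3 \<Rightarrow> int" where
  "garside_exponent g = snd (garside_form g)"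


text \<open>Steps are indexed from \<open>1\<close>; the value \<open>x 0\<close> plays no role.\<close>

definition iid_steps :: "'w measure \<Rightarrow> braid3 pmf \<Rightarrow> (nat \<Rightarrow> 'w \<Rightarrow> braid3) \<Rightarrow> bool" where
  "iid_steps M \<nu> x \<longleftrightarrow>
     prob_space M \<and>
     prob_space.indep_vars M (\<lambda>_. count_space UNIV) x {1..} \<and>
     (\<forall>i\<ge>1. distr M (count_space UNIV) (x i) = measure_pmf \<nu>)"

primrec walk :: "(nat \<Rightarrow> 'w \<Rightarrow> braid3) \<Rightarrow> nat \<Rightarrow> 'w \<Rightarrow> braid3" where
  "walk x 0 \<omega> = \<one>\<^bsub>B3\<^esub>"
| "walk x (Suc n) \<omega> = walk x n \<omega> \<otimes>\<^bsub>B3\<^esub> x (Suc n) \<omega>"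

definition has_drift ::
  "'w measure \<Rightarrow> (nat \<Rightarrow> 'w \<Rightarrow> braid3) \<Rightarrow> (braid3 \<Rightarrow> real) \<Rightarrow> real \<Rightarrow> bool" where
  "has_drift M x f c \<longleftrightarrow>
     (AE \<omega> in M. (\<lambda>n. f (walk x n \<omega>) / real n) \<longlonglongrightarrow> c)"

text \<open>
  The closed formulas for the drifts have quotients of the form \<open>0 / 0\<close> at \<open>p = 1/4\<close>;
  there they are read as their limits for \<open>p \<rightarrow> 1/4\<close>.
\<close>

definition extended_at_quarter :: "(real \<Rightarrow> real) \<Rightarrow> real \<Rightarrow> real" where
  "extended_at_quarter f p = (if p = 1/4 then Lim (at (1/4)) f else f p)"

end

theory Submission
  imports Defs
begin

text \<open>
  Right multiplication by a generator changes only the last factor of a Garside normal form and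
  the exponent of \<open>\<Delta>\<close>. Forgetting which of the two letters a factor starts with, the walk
  becomes a random walk on stacks over \<open>{1, 2}\<close> (the lengths of the factors), whose
  increments depend only on the top symbol. If \<open>F\<close> is linear in the number of factors, the
  number of letters and the exponent, then adding a bounded function \<open>h\<close> of the stack, with
  \<open>h(s1) = 2w\<beta> + (1 - w) h(s)\<close> and \<open>h(s2) = w h(s)\<close>, makes \<open>F(X\<^sub>n) + h(X\<^sub>n) - c n\<close> a martingale
  with bounded increments. Here \<open>w\<close>, the asymptotic frequency of the top symbol \<open>1\<close>, is a root
  of \<open>(2p - 1/2)(w - w\<^sup>2) = w - 1/2\<close>. Hoeffding's lemma and Borel-Cantelli then give the drift \<open>c\<close>.
  The word length is the maximum of four such linear functions.
\<close>

section \<open>The Garside normal form\<close>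

text \<open>
  The pair \<open>(f, d)\<close> stands for the simple element with first letter \<open>f\<close> (\<open>True\<close> for \<open>b\<close>), which has
  two letters iff \<open>d\<close>. In a state the list of factors is reversed, so that the last factor is the head.
\<close>
type_synonym simple_elt = "bool \<times> bool"

fun last_letter :: "simple_elt \<Rightarrow> bool" where
  "last_letter (f, d) = (f \<noteq> d)"

type_synonym garside_state = "simple_elt list \<times> int"

text \<open>
  Multiplication of \<open>t\<^sub>1\<cdots>t\<^sub>l\<close> by a letter \<open>c\<close> or its inverse on the right. Moving a letter across
  \<open>\<Delta>\<^sup>k\<close> swaps \<open>a\<close> and \<open>b\<close> iff \<open>k\<close> is odd, and \<open>c\<inverse> = c'c\<Delta>\<inverse>\<close> for the other letter \<open>c'\<close>.
\<close>
fun mult_pos :: "bool \<Rightarrow> garside_state \<Rightarrow> garside_state" where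
  "mult_pos c ([], k) = ([(c, False)], k)"
| "mult_pos c ((f, d) # ts, k) =
     (if last_letter (f, d) = c then ((c, False) # (f, d) # ts, k)
      else if d then (ts, k + 1) else ((f, True) # ts, k))"

fun mult_neg :: "bool \<Rightarrow> garside_state \<Rightarrow> garside_state" where
  "mult_neg c ([], k) = ([(\<not> c, True)], k - 1)"
| "mult_neg c ((f, d) # ts, k) =
     (if last_letter (f, d) = c then (if d then ((f, False) # ts, k) else (ts, k))
      else ((\<not> c, True) # (f, d) # ts, k - 1))"

fun act :: "garside_state \<Rightarrow> letter \<Rightarrow> garside_state" where
  "act s La = mult_pos (odd (snd s)) s"
| "act s Lb = mult_pos (even (snd s)) s"
| "act s La_inv = mult_neg (odd (snd s)) s"
| "act s Lb_inv = mult_neg (even (snd s)) s"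

section \<open>The action of letters on states respects the relations of the group\<close>

fun chain :: "simple_elt list \<Rightarrow> bool" where
  "chain (t # u # ts) \<longleftrightarrow> last_letter u = fst t \<and> chain (u # ts)"
| "chain _ \<longleftrightarrow> True"

lemma chain_tl: "chain (t # ts) \<Longrightarrow> chain ts"
  by (cases ts) auto

lemma chain_act: "chain (fst s) \<Longrightarrow> chain (fst (act s x))"
  by (cases "(x, s)" rule: prod.exhaust; cases s; cases "fst s" rule: chain.cases; cases x)
    (auto split: if_splits)

lemma chain_foldl_act: "chain (fst s) \<Longrightarrow> chain (fst (foldl act s w))"
  by (induction w arbitrary: s) (auto simp: chain_act)

text \<open>Only the top factors change, so a finite case check suffices. \<open>chain\<close>
  matters when a factor is popped and pushed back: the factor below must end in the returning
  letter, or the two would merge.\<close>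

lemma act_letter_inv:
  assumes "chain (fst s)"
  shows "act (act s x) (letter_inv x) = s"
  using assms
  by (cases s; cases "fst s" rule: chain.cases; cases x) (auto split: if_splits)

lemma act_braid_relation:
  assumes "chain (fst s)"
  shows "act (act (act s La) Lb) La = act (act (act s Lb) La) Lb"
  using assms
  by (cases s; cases "fst s" rule: chain.cases) (auto split: if_splits)

lemma act_Delta:
  assumes "chain ts"
  shows "act (act (act (ts, k) La) Lb) La = (ts, k + 1)"
  using assms by (cases ts rule: chain.cases) (auto split: if_splits)

text \<open>Both kinds of defining relation hold for the action at chain states, and every state
  reached from \<open>([], 0)\<close> is a chain. This makes \<open>nf\<close> well defined on the
  quotient.\<close>

lemma braid_eq_foldl_act:
  "braid_eq u v \<Longrightarrow> foldl act ([], 0) u = foldl act ([], 0) v"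
  by (induction rule: braid_eq.induct)
    (simp_all del: act.simps add: act_letter_inv act_braid_relation chain_foldl_act)

lift_definition nf :: "braid3 \<Rightarrow> garside_state" is "foldl act ([], 0)"
  by (rule braid_eq_foldl_act)

section \<open>Generators and products in the braid group\<close>

interpretation B3: group B3
  by (rule group_B3)

lift_definition braid_gen :: "letter \<Rightarrow> braid3" is "\<lambda>x. [x]" .

lemma carrier_B3 [simp]: "carrier B3 = UNIV" 
  by (simp add: B3_def)

lemma B3_inv_cancel [simp]:
  "g \<otimes>\<^bsub>B3\<^esub> (inv\<^bsub>B3\<^esub> g \<otimes>\<^bsub>B3\<^esub> h) = h" "inv\<^bsub>B3\<^esub> g \<otimes>\<^bsub>B3\<^esub> (g \<otimes>\<^bsub>B3\<^esub> h) = h"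
  by (simp_all flip: B3.m_assoc)

lemma mult_B3: "g \<otimes>\<^bsub>B3\<^esub> h = braid3_mult g h"
  by (simp add: B3_def)

lemma nf_mult_gen: "nf (g \<otimes>\<^bsub>B3\<^esub> braid_gen x) = act (nf g) x"
  unfolding mult_B3 by transfer simp

lemma nf_one: "nf \<one>\<^bsub>B3\<^esub> = ([], 0)"
  by (simp add: B3_def, transfer, simp)

lemma chain_nf: "chain (fst (nf g))"
  by transfer (simp add: chain_foldl_act)

lemma braid_gen_positive: "braid_gen La = gen_a" "braid_gen Lb = gen_b"
  by (transfer, simp add: braid_eq_refl)+

lemma braid_gen_mult_inv: "braid_gen x \<otimes>\<^bsub>B3\<^esub> braid_gen (letter_inv x) = \<one>\<^bsub>B3\<^esub>"
proof -
  have "braid3_mult (braid_gen x) (braid_gen (letter_inv x)) = braid3_one"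
    apply transfer
    using braid_eq_cancel[of "[]" _ "[]"] by simp
  then show ?thesis by (simp add: B3_def)
qed

lemma braid_gen_letter_inv: "braid_gen (letter_inv x) = inv\<^bsub>B3\<^esub> braid_gen x"
  using B3.inv_equality[OF _ , of "braid_gen (letter_inv x)" "braid_gen x"]
    braid_gen_mult_inv[of "letter_inv x"] by simp

lemma braid_gen_negative: "braid_gen La_inv = inv\<^bsub>B3\<^esub> gen_a" "braid_gen Lb_inv = inv\<^bsub>B3\<^esub> gen_b"
  using braid_gen_letter_inv[of La] braid_gen_letter_inv[of Lb] by (simp_all add: braid_gen_positive)

lemmas braid_gen_simps = braid_gen_positive braid_gen_negative

lemma UNIV_letter: "UNIV = {La, La_inv, Lb, Lb_inv}"
  using letter.exhaust by auto

lemma B3_gens_eq: "B3_gens = range braid_gen"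
  by (simp add: UNIV_letter B3_gens_def braid_gen_simps)

text \<open>The four letters already act differently on the trivial state. This allows sums over
  \<open>B3_gens\<close> to be reindexed by letters.\<close>

lemma inj_braid_gen: "inj braid_gen"
proof (rule injI)
  fix x y assume "braid_gen x = braid_gen y"
  then have "act ([], 0) x = act ([], 0) y"
    using nf_mult_gen[of "\<one>\<^bsub>B3\<^esub>" x] nf_mult_gen[of "\<one>\<^bsub>B3\<^esub>" y] by (simp add: nf_one)
  then show "x = y" by (cases x; cases y) auto
qed

lemma B3_prod_simps [simp]: 
  "B3_prod [] = \<one>\<^bsub>B3\<^esub>" "B3_prod (g # gs) = g \<otimes>\<^bsub>B3\<^esub> B3_prod gs"
  by (simp_all add: B3_prod_def)

lemma B3_prod_append [simp]: "B3_prod (gs @ hs) = B3_prod gs \<otimes>\<^bsub>B3\<^esub> B3_prod hs"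
  by (induction gs) (simp_all add: B3.m_assoc)

lemma braid_relation: "gen_a \<otimes>\<^bsub>B3\<^esub> gen_b \<otimes>\<^bsub>B3\<^esub> gen_a = gen_b \<otimes>\<^bsub>B3\<^esub> gen_a \<otimes>\<^bsub>B3\<^esub> gen_b"
  unfolding mult_B3 apply transfer
  using braid_eq_braid[of "[]" "[]"] by simp

section \<open>From states back to braids: existence and uniqueness of the normal form\<close>

definition atom :: "bool \<Rightarrow> braid3" where
  "atom c = (if c then gen_b else gen_a)"

fun simple_braid :: "simple_elt \<Rightarrow> braid3" where
  "simple_braid (f, d) = (if d then atom f \<otimes>\<^bsub>B3\<^esub> atom (\<not> f) else atom f)"

definition state_braid :: "garside_state \<Rightarrow> braid3" where
  "state_braid s = B3_prod (map simple_braid (rev (fst s))) \<otimes>\<^bsub>B3\<^esub> garside_Delta [^]\<^bsub>B3\<^esub> snd s"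

lemma Delta_eq_atoms: "garside_Delta = atom c \<otimes>\<^bsub>B3\<^esub> atom (\<not> c) \<otimes>\<^bsub>B3\<^esub> atom c"
  by (simp add: garside_Delta_def atom_def braid_relation)

text \<open>Re-bracketing \<open>c'cc'c\<close>, where \<open>c'\<close> is the other letter, passes
  from one spelling of \<Delta> to the other.\<close>

lemma Delta_mult_atom: "garside_Delta \<otimes>\<^bsub>B3\<^esub> atom c = atom (\<not> c) \<otimes>\<^bsub>B3\<^esub> garside_Delta"
proof -
  have "garside_Delta \<otimes>\<^bsub>B3\<^esub> atom c = (atom (\<not> c) \<otimes>\<^bsub>B3\<^esub> atom c \<otimes>\<^bsub>B3\<^esub> atom (\<not> c)) \<otimes>\<^bsub>B3\<^esub> atom c"
    using Delta_eq_atoms[of "\<not> c"] by simp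
  also have "\<dots> = atom (\<not> c) \<otimes>\<^bsub>B3\<^esub> (atom c \<otimes>\<^bsub>B3\<^esub> atom (\<not> c) \<otimes>\<^bsub>B3\<^esub> atom c)"
    by (simp add: B3.m_assoc)
  finally show ?thesis using Delta_eq_atoms[of c] by simp
qed

lemma Delta_pow_mult_atom:
  "garside_Delta [^]\<^bsub>B3\<^esub> (k::int) \<otimes>\<^bsub>B3\<^esub> atom c = atom (c \<noteq> odd k) \<otimes>\<^bsub>B3\<^esub> garside_Delta [^]\<^bsub>B3\<^esub> k"
proof (induction k arbitrary: c rule: int_induct[where k = 0])
  case base
  show ?case by simp
next
  case (step1 i)
  have "garside_Delta [^]\<^bsub>B3\<^esub> (i + 1) \<otimes>\<^bsub>B3\<^esub> atom c 
      = garside_Delta [^]\<^bsub>B3\<^esub> i \<otimes>\<^bsub>B3\<^esub> (garside_Delta \<otimes>\<^bsub>B3\<^esub> atom c)"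
    by (simp add: B3.int_pow_mult B3.m_assoc)
  also have "\<dots> = garside_Delta [^]\<^bsub>B3\<^esub> i \<otimes>\<^bsub>B3\<^esub> atom (\<not> c) \<otimes>\<^bsub>B3\<^esub> garside_Delta"
    by (simp add: B3.m_assoc Delta_mult_atom)
  finally show ?case by (simp add: step1 B3.int_pow_mult B3.m_assoc)
next
  case (step2 i)
  \<comment> \<open>Going down, the hypothesis for \<open>i\<close> is applied to the other letter;
    it yields the claim multiplied on the right by \<Delta>, which is then cancelled.\<close>
  have "garside_Delta [^]\<^bsub>B3\<^esub> i = garside_Delta [^]\<^bsub>B3\<^esub> (i - 1) \<otimes>\<^bsub>B3\<^esub> garside_Delta"
    using B3.int_pow_mult[of garside_Delta "i - 1" 1] by simp
  then have "garside_Delta [^]\<^bsub>B3\<^esub> (i - 1) \<otimes>\<^bsub>B3\<^esub> atom c \<otimes>\<^bsub>B3\<^esub> garside_Delta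
      = garside_Delta [^]\<^bsub>B3\<^esub> i \<otimes>\<^bsub>B3\<^esub> atom (\<not> c)"
    using Delta_mult_atom[of "\<not> c"] by (simp add: B3.m_assoc)
  also have "\<dots> = atom ((\<not> c) \<noteq> odd i) \<otimes>\<^bsub>B3\<^esub> garside_Delta [^]\<^bsub>B3\<^esub> i"
    by (rule step2)
  also have "\<dots> = atom (c \<noteq> odd (i - 1)) \<otimes>\<^bsub>B3\<^esub> garside_Delta [^]\<^bsub>B3\<^esub> (i - 1) \<otimes>\<^bsub>B3\<^esub> garside_Delta"
    using \<open>garside_Delta [^]\<^bsub>B3\<^esub> i = _\<close> by (simp add: B3.m_assoc)
  finally show ?case by simp
qed

lemma Delta_pow_plus_one:
  "garside_Delta [^]\<^bsub>B3\<^esub> (k + 1) =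
     atom c \<otimes>\<^bsub>B3\<^esub> (atom (\<not> c) \<otimes>\<^bsub>B3\<^esub> (atom c \<otimes>\<^bsub>B3\<^esub> garside_Delta [^]\<^bsub>B3\<^esub> (k::int)))"
proof -
  have "garside_Delta [^]\<^bsub>B3\<^esub> (k + 1) = garside_Delta \<otimes>\<^bsub>B3\<^esub> garside_Delta [^]\<^bsub>B3\<^esub> k"
    using B3.int_pow_mult[of garside_Delta 1 k] by (simp add: add.commute)
  then show ?thesis
    by (simp add: Delta_eq_atoms[of c] B3.m_assoc)
qed

lemma state_braid_mult_pos:
  "state_braid (mult_pos c s) =
     B3_prod (map simple_braid (rev (fst s))) \<otimes>\<^bsub>B3\<^esub> atom c \<otimes>\<^bsub>B3\<^esub> garside_Delta [^]\<^bsub>B3\<^esub> snd s"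
  by (cases "(c, s)" rule: mult_pos.cases)
    (auto simp: state_braid_def B3.m_assoc Delta_pow_plus_one[of _ c])

lemma state_braid_mult_neg:
  "state_braid (mult_neg c s) =
     B3_prod (map simple_braid (rev (fst s))) \<otimes>\<^bsub>B3\<^esub> inv\<^bsub>B3\<^esub> atom c \<otimes>\<^bsub>B3\<^esub> garside_Delta [^]\<^bsub>B3\<^esub> snd s"
proof -
  have "atom (\<not> c) \<otimes>\<^bsub>B3\<^esub> (atom c \<otimes>\<^bsub>B3\<^esub> garside_Delta [^]\<^bsub>B3\<^esub> (k - 1)) =
      inv\<^bsub>B3\<^esub> atom c \<otimes>\<^bsub>B3\<^esub> garside_Delta [^]\<^bsub>B3\<^esub> k" for k :: int
    using Delta_pow_plus_one[of "k - 1" c] by (simp flip: B3.m_assoc)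
  then show ?thesis
    by (cases "(c, s)" rule: mult_neg.cases)
      (auto simp: state_braid_def B3.m_assoc)
qed

lemma Delta_pow_mult_inv_atom:
  "garside_Delta [^]\<^bsub>B3\<^esub> (k::int) \<otimes>\<^bsub>B3\<^esub> inv\<^bsub>B3\<^esub> atom c =
     inv\<^bsub>B3\<^esub> atom (c \<noteq> odd k) \<otimes>\<^bsub>B3\<^esub> garside_Delta [^]\<^bsub>B3\<^esub> k"
proof -
  have "garside_Delta [^]\<^bsub>B3\<^esub> k = inv\<^bsub>B3\<^esub> atom (c \<noteq> odd k) \<otimes>\<^bsub>B3\<^esub> (garside_Delta [^]\<^bsub>B3\<^esub> k \<otimes>\<^bsub>B3\<^esub> atom c)"
    by (simp add: Delta_pow_mult_atom flip: B3.m_assoc)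
  then have "garside_Delta [^]\<^bsub>B3\<^esub> k \<otimes>\<^bsub>B3\<^esub> inv\<^bsub>B3\<^esub> atom c =
      inv\<^bsub>B3\<^esub> atom (c \<noteq> odd k) \<otimes>\<^bsub>B3\<^esub> (garside_Delta [^]\<^bsub>B3\<^esub> k \<otimes>\<^bsub>B3\<^esub> atom c) \<otimes>\<^bsub>B3\<^esub> inv\<^bsub>B3\<^esub> atom c"
    by metis
  then show ?thesis by (simp add: B3.m_assoc)
qed

lemma braid_gen_atom:
  "braid_gen La = atom False" "braid_gen Lb = atom True"
  "braid_gen La_inv = inv\<^bsub>B3\<^esub> atom False" "braid_gen Lb_inv = inv\<^bsub>B3\<^esub> atom True"
  by (simp_all add: atom_def braid_gen_simps)

text \<open>\<open>c \<noteq> odd (snd s)\<close> is what the letter \<open>c\<close> becomes when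
  moved left across the power of \<Delta>, and it is the letter that \<open>act\<close> hands to
  \<open>mult_pos\<close> and \<open>mult_neg\<close>.\<close>

lemma state_braid_act: "state_braid (act s x) = state_braid s \<otimes>\<^bsub>B3\<^esub> braid_gen x"
proof -
  have "state_braid (mult_pos (c \<noteq> odd (snd s)) s) = state_braid s \<otimes>\<^bsub>B3\<^esub> atom c"
    "state_braid (mult_neg (c \<noteq> odd (snd s)) s) = state_braid s \<otimes>\<^bsub>B3\<^esub> inv\<^bsub>B3\<^esub> atom c" for c
    unfolding state_braid_mult_pos state_braid_mult_neg
    by (simp_all add: state_braid_def B3.m_assoc Delta_pow_mult_atom Delta_pow_mult_inv_atom)
  from this[of False] this[of True] show ?thesis
    by (cases x) (simp_all add: braid_gen_atom)
qed

lemma braid3_induct [case_names one mult]: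
  assumes one: "P \<one>\<^bsub>B3\<^esub>" and mult: "\<And>g x. P g \<Longrightarrow> P (g \<otimes>\<^bsub>B3\<^esub> braid_gen x)"
  shows "P g"
proof -
  have "P (abs_braid3 w)" for w
  proof (induction w rule: rev_induct)
    case Nil
    then show ?case using one by (simp add: B3_def braid3_one_def)
  next
    case (snoc x w)
    have "abs_braid3 (w @ [x]) = abs_braid3 w \<otimes>\<^bsub>B3\<^esub> braid_gen x"
      unfolding mult_B3 braid_gen_def by (simp add: braid3_mult.abs_eq)
    then show ?case using mult[OF snoc] by simp
  qed
  then show ?thesis by (metis Quotient3_abs_rep Quotient3_braid3)
qed

text \<open>Existence half of the normal form theorem: \<open>nf\<close> and
  \<open>state_braid\<close> both turn right multiplication by a generator into \<open>act\<close>,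
  and conversely.\<close>

lemma state_braid_nf: "state_braid (nf g) = g"
  by (induction g rule: braid3_induct)
    (simp_all del: act.simps add: nf_mult_gen state_braid_act, simp add: nf_one state_braid_def)

lemma nf_mult_simple_braid:
  assumes "nf g = (ts, 0)" "chain (t # ts)"
  shows "nf (g \<otimes>\<^bsub>B3\<^esub> simple_braid t) = (t # ts, 0)"
  using assms
  by (cases t; cases ts rule: chain.cases)
    (auto simp: atom_def nf_mult_gen simp flip: B3.m_assoc braid_gen_positive)

lemma nf_mult_Delta:
  assumes "nf g = (ts, k)"
  shows "nf (g \<otimes>\<^bsub>B3\<^esub> garside_Delta) = (ts, k + 1)"
proof -
  have "g \<otimes>\<^bsub>B3\<^esub> garside_Delta = g \<otimes>\<^bsub>B3\<^esub> braid_gen La \<otimes>\<^bsub>B3\<^esub> braid_gen Lb \<otimes>\<^bsub>B3\<^esub> braid_gen La"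
    by (simp add: garside_Delta_def braid_gen_simps B3.m_assoc)
  moreover have "chain ts" using chain_nf[of g] assms by simp
  ultimately show ?thesis
    using assms act_Delta[of ts k] by (simp del: act.simps add: nf_mult_gen)
qed

lemma nf_mult_Delta_pow:
  assumes "nf g = (ts, k)"
  shows "nf (g \<otimes>\<^bsub>B3\<^esub> garside_Delta [^]\<^bsub>B3\<^esub> (m::int)) = (ts, k + m)"
proof (induction m rule: int_induct[where k = 0])
  case base
  then show ?case using assms by simp
next
  case (step1 i)
  have "garside_Delta [^]\<^bsub>B3\<^esub> (i + 1) = garside_Delta [^]\<^bsub>B3\<^esub> i \<otimes>\<^bsub>B3\<^esub> garside_Delta"
    by (simp add: B3.int_pow_mult)
  then show ?case using nf_mult_Delta[OF step1(2)] by (simp add: B3.m_assoc add.assoc)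
next
  case (step2 i)
  \<comment> \<open>The state at \<open>i - 1\<close> is left unknown. Multiplication by \<Delta>
    only raises the exponent by one, so comparison with the known state at \<open>i\<close>
    determines it.\<close>
  obtain us j where uj: "nf (g \<otimes>\<^bsub>B3\<^esub> garside_Delta [^]\<^bsub>B3\<^esub> (i - 1)) = (us, j)"
    by fastforce
  have "garside_Delta [^]\<^bsub>B3\<^esub> i = garside_Delta [^]\<^bsub>B3\<^esub> (i - 1) \<otimes>\<^bsub>B3\<^esub> garside_Delta"
    using B3.int_pow_mult[of garside_Delta "i - 1" 1] by simp
  then show ?case using nf_mult_Delta[OF uj] step2(2) uj by (simp add: B3.m_assoc)
qed

text \<open>Uniqueness half: multiplying the factors of a chain one by one pushes each onto the
  state unchanged, and the power of \<Delta> then only sets the exponent.\<close>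

lemma nf_state_braid:
  assumes "chain (fst s)"
  shows "nf (state_braid s) = s"
proof -
  have "chain ts \<Longrightarrow> nf (B3_prod (map simple_braid (rev ts))) = (ts, 0)" for ts
    by (induction ts)
      (auto simp: nf_one simp del: simple_braid.simps intro: nf_mult_simple_braid dest: chain_tl)
  from nf_mult_Delta_pow[OF this[OF assms], of "snd s"] show ?thesis
    by (simp add: state_braid_def)
qed

section \<open>Comparison with the defined Garside form\<close>

text \<open>\<open>First\<close>, \<open>Last\<close> and \<open>letter_count\<close> test equality
  of group elements; injectivity reduces these tests to equality of pairs.\<close>

lemma inj_simple_braid: "inj simple_braid"
proof (rule injI)
  fix t u assume "simple_braid t = simple_braid u"
  then show "t = u"
    using nf_mult_simple_braid[OF nf_one, of t] nf_mult_simple_braid[OF nf_one, of u] by simp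
qed

lemma garside_T_eq: "garside_T = range simple_braid"
proof -
  have "(UNIV :: simple_elt set) = {(False, False), (True, False), (False, True), (True, True)}"
    by auto
  then show ?thesis unfolding garside_T_def \<open>UNIV = _\<close> by (simp add: atom_def)
qed

lemma simple_braid_eqs:
  "gen_a = simple_braid (False, False)" "gen_b = simple_braid (True, False)"
  "gen_a \<otimes>\<^bsub>B3\<^esub> gen_b = simple_braid (False, True)"
  "gen_b \<otimes>\<^bsub>B3\<^esub> gen_a = simple_braid (True, True)"
  by (simp_all add: atom_def)

lemma First_simple_braid: "First (simple_braid t) = atom (fst t)"
  \<comment> \<open>The products are rewritten before the single generators, since otherwise their
    factors would be replaced first and the products no longer recognised.\<close>
  unfolding First_def atom_def simple_braid_eqs(3,4)
  unfolding simple_braid_eqs(1,2)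
  by (cases t) (auto simp: inj_eq[OF inj_simple_braid] simp del: simple_braid.simps)

lemma Last_simple_braid: "Last (simple_braid t) = atom (last_letter t)"
  unfolding Last_def atom_def simple_braid_eqs(3,4)
  unfolding simple_braid_eqs(1,2)
  by (cases t) (auto simp: inj_eq[OF inj_simple_braid] simp del: simple_braid.simps)

lemma letter_count_simple_braid: "letter_count (simple_braid t) = (if snd t then 2 else 1)"
  unfolding letter_count_def atom_def simple_braid_eqs(3,4)
  unfolding simple_braid_eqs(1,2)
  by (cases t) (auto simp: inj_eq[OF inj_simple_braid] simp del: simple_braid.simps)

lemma inj_atom: "atom c = atom d \<longleftrightarrow> c = d"
  using inj_eq[OF inj_simple_braid, of "(c, False)" "(d, False)"] by simp

lemma chain_iff_nth:
  "chain ts \<longleftrightarrow> (\<forall>i. Suc i < length ts \<longrightarrow> last_letter (ts ! Suc i) = fst (ts ! i))"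
proof (induction ts rule: chain.induct)
  case (1 t u ts)
  show ?case
    unfolding chain.simps(1) 1 by (auto simp: nth_Cons less_Suc_eq_0_disj split: nat.split)
qed auto

lemma chain_rev_iff:
  "chain (rev ts) \<longleftrightarrow> (\<forall>i. Suc i < length ts \<longrightarrow> last_letter (ts ! i) = fst (ts ! Suc i))"
proof -
  have "chain (rev ts) \<longleftrightarrow>
      (\<forall>i. Suc i < length ts \<longrightarrow> last_letter (rev ts ! Suc i) = fst (rev ts ! i))"
    by (simp add: chain_iff_nth)
  also have "\<dots> \<longleftrightarrow> (\<forall>i. Suc i < length ts \<longrightarrow>
      last_letter (ts ! (length ts - Suc (Suc i))) = fst (ts ! (length ts - Suc i)))"
    by (intro all_cong) (simp add: rev_nth)
  also have "\<dots> \<longleftrightarrow> (\<forall>i. Suc i < length ts \<longrightarrow> last_letter (ts ! i) = fst (ts ! Suc i))"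
    (is "?L \<longleftrightarrow> ?R")
  proof
    \<comment> \<open>The reflection of \<open>i\<close> to \<open>length ts - 2 - i\<close> is an
      involution of the index range, so both directions instantiate at the same index.\<close>
    show ?R if ?L
    proof (intro allI impI)
      fix i assume "Suc i < length ts"
      then show "last_letter (ts ! i) = fst (ts ! Suc i)"
        using that[rule_format, of "length ts - Suc (Suc i)"] by (simp add: Suc_diff_Suc)
    qed
    show ?L if ?R
    proof (intro allI impI)
      fix i assume "Suc i < length ts"
      then show "last_letter (ts ! (length ts - Suc (Suc i))) = fst (ts ! (length ts - Suc i))"
        using that[rule_format, of "length ts - Suc (Suc i)"] by (simp add: Suc_diff_Suc)
    qed
  qed
  finally show ?thesis .
qed

text \<open>Combines existence and uniqueness, so that the definite description in
  \<open>garside_form\<close> can be evaluated.\<close>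

lemma is_garside_form_iff:
  "is_garside_form g us k \<longleftrightarrow> us = map simple_braid (rev (fst (nf g))) \<and> k = snd (nf g)"
proof -
  have form: "is_garside_form g (map simple_braid ts) k \<longleftrightarrow> chain (rev ts) \<and> g = state_braid (rev ts, k)" for ts
    by (auto simp: is_garside_form_def chain_rev_iff garside_T_eq Last_simple_braid First_simple_braid
        inj_atom state_braid_def)
  show ?thesis
  proof
    assume gf: "is_garside_form g us k"
    then obtain ts where ts: "us = map simple_braid ts"
      by (metis is_garside_form_def garside_T_eq ex_map_conv rangeE subsetD)
    then show "us = map simple_braid (rev (fst (nf g))) \<and> k = snd (nf g)"
      using gf nf_state_braid[of "(rev ts, k)"] by (simp add: form)
  next
    assume "us = map simple_braid (rev (fst (nf g))) \<and> k = snd (nf g)"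
    then show "is_garside_form g us k"
      using form[of "rev (fst (nf g))"] chain_nf[of g] state_braid_nf[of g] by simp
  qed
qed

lemma garside_form_eq: "garside_form g = (map simple_braid (rev (fst (nf g))), snd (nf g))"
  unfolding garside_form_def is_garside_form_iff by (rule the_equality) auto

definition count_letters :: "simple_elt list \<Rightarrow> nat" where
  "count_letters ts = sum_list (map (\<lambda>t. if snd t then 2 else 1) ts)"

lemma garside_length_T_eq: "garside_length_T g = length (fst (nf g))"
  by (simp add: garside_length_T_def garside_form_eq)

lemma garside_length_pos_eq: "garside_length_pos g = count_letters (fst (nf g))"
  by (simp add: garside_length_pos_def garside_form_eq count_letters_def
      letter_count_simple_braid comp_def sum_list_rev flip: rev_map)

lemma garside_exponent_eq: "garside_exponent g = snd (nf g)"
  by (simp add: garside_exponent_def garside_form_eq)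

section \<open>Word length\<close>

lemma count_letters_simps [simp]:
  "count_letters [] = 0" "count_letters ((f, d) # ts) = (if d then 2 else 1) + count_letters ts"
  by (simp_all add: count_letters_def)

lemma count_letters_bounds: "length ts \<le> count_letters ts" "count_letters ts \<le> 2 * length ts"
  by (induction ts) (auto simp: count_letters_def)

text \<open>A candidate for the word length. For negative \<open>k\<close>, absorbing an inverse of
  \<Delta> into a factor of two letters leaves one inverse letter, and into a factor of one letter
  leaves two. Using two-letter factors first, then one-letter ones, gives the four terms for
  \<open>k \<ge> 0\<close>, \<open>L - S \<le> k \<le> 0\<close>,
  \<open>- L \<le> k \<le> L - S\<close> and \<open>k \<le> - L\<close>, in this order.\<close>

definition max_norm :: "garside_state \<Rightarrow> int" where
  "max_norm s = (let S = int (count_letters (fst s)); L = int (length (fst s)); k = snd s in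
     Max {S + 3 * k, S + k, 2 * L - S - k, - S - 3 * k})"

lemma max_norm_le_iff:
  "max_norm (ts, k) \<le> m \<longleftrightarrow>
     int (count_letters ts) + 3 * k \<le> m \<and> int (count_letters ts) + k \<le> m \<and>
     2 * int (length ts) - int (count_letters ts) - k \<le> m \<and> - int (count_letters ts) - 3 * k \<le> m"
  by (simp add: max_norm_def Let_def)

text \<open>Each of the four linear functions changes by exactly one in absolute value. This gives
  the lower bound for the word length.\<close>

lemma max_norm_mult_le:
  "max_norm (mult_pos c s) \<le> max_norm s + 1" "max_norm (mult_neg c s) \<le> max_norm s + 1"
proof -
  obtain ts k where s: "s = (ts, k)" by fastforce
  \<comment> \<open>Unfolding this trivial inequality bounds each of the four linear functions by
    the maximum.\<close>
  have "max_norm (ts, k) \<le> max_norm (ts, k)" by simp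
  note * = this[unfolded max_norm_le_iff]
  show "max_norm (mult_pos c s) \<le> max_norm s + 1"
    unfolding s by (cases "(c, (ts, k))" rule: mult_pos.cases) (use * in \<open>auto simp: max_norm_le_iff\<close>)
  show "max_norm (mult_neg c s) \<le> max_norm s + 1"
    unfolding s by (cases "(c, (ts, k))" rule: mult_neg.cases) (use * in \<open>auto simp: max_norm_le_iff\<close>)
qed

lemma mult_pos_eq_act: "mult_pos c s = act s (if c = odd (snd s) then La else Lb)"
  by (cases c) simp_all

lemma mult_neg_eq_act: "mult_neg c s = act s (if c = odd (snd s) then La_inv else Lb_inv)"
  by (cases c) simp_all

lemma max_norm_act_le: "max_norm (act s x) \<le> max_norm s + 1"
  using max_norm_mult_le by (cases x) (simp_all del: mult_pos.simps mult_neg.simps)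

text \<open>
  The four functions have the same parity, so it suffices to find a generator that decreases all those
  that attain the maximum; which ones do is read off the sign of \<open>k\<close> (top of length 2) or of \<open>k + l\<close> (top of length 1).
\<close>
lemma ex_max_norm_act_less:
  assumes "s \<noteq> ([], 0)"
  shows "\<exists>x. max_norm (act s x) < max_norm s"
proof -
  obtain ts k where s: "s = (ts, k)" by fastforce
  have "max_norm (ts, k) \<le> max_norm (ts, k)" by simp
  note * = this[unfolded max_norm_le_iff]
  have "\<exists>c. max_norm (mult_pos c s) < max_norm s \<or> max_norm (mult_neg c s) < max_norm s"
  proof (cases ts)
    case Nil
    show ?thesis
    proof (cases "k > 0")
      case True
      then have "max_norm (mult_neg True s) < max_norm s"
        \<comment> \<open>Over the integers \<open><\<close> becomes \<open>\<le>\<close> with 1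
          subtracted, the shape to which \<open>max_norm_le_iff\<close> applies.\<close>
        using * Nil unfolding s zle_diff1_eq[symmetric] by (simp add: max_norm_le_iff del: zle_diff1_eq)
      then show ?thesis by blast
    next
      case False
      then have "max_norm (mult_pos True s) < max_norm s"
        using * Nil assms unfolding s zle_diff1_eq[symmetric] by (simp add: max_norm_le_iff del: zle_diff1_eq)
      then show ?thesis by blast
    qed
  next
    case (Cons t us)
    obtain f d where t: "t = (f, d)" by fastforce
    note b = count_letters_bounds[of us]
    show ?thesis
    proof (cases d)
      case False
      have "max_norm (mult_pos (\<not> f) s) < max_norm s \<or> max_norm (mult_neg f s) < max_norm s"
        using * b Cons t False unfolding s zle_diff1_eq[symmetric]
        by (cases "k + int (length ts) \<le> 0") (simp_all add: max_norm_le_iff del: zle_diff1_eq)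
      then show ?thesis by blast
    next
      case True
      have "max_norm (mult_neg (\<not> f) s) < max_norm s \<or> max_norm (mult_pos f s) < max_norm s"
        using * b Cons t True unfolding s zle_diff1_eq[symmetric]
        by (cases "k \<ge> 0") (simp_all add: max_norm_le_iff del: zle_diff1_eq)
      then show ?thesis by blast
    qed
  qed
  then obtain c where "max_norm (mult_pos c s) < max_norm s \<or> max_norm (mult_neg c s) < max_norm s" ..
  then show ?thesis
    using mult_pos_eq_act[of c s] mult_neg_eq_act[of c s] by metis
qed

lemma max_norm_nonneg: "max_norm s \<ge> 0"
proof -
  obtain ts k where s: "s = (ts, k)" by fastforce
  have "max_norm (ts, k) \<le> max_norm (ts, k)" by simp
  \<comment> \<open>The first and the last linear function are negatives of each other.\<close>
  then show ?thesis unfolding s max_norm_le_iff by linarith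
qed

lemma max_norm_Nil: "max_norm ([], 0) = 0"
  by (simp add: max_norm_def)

lemma max_norm_le_length:
  "set gs \<subseteq> B3_gens \<Longrightarrow> max_norm (nf (B3_prod gs)) \<le> int (length gs)"
proof (induction gs rule: rev_induct)
  case (snoc g gs)
  obtain x where "g = braid_gen x" using snoc.prems by (auto simp: B3_gens_eq)
  then show ?case
    using snoc max_norm_act_le[of "nf (B3_prod gs)" x] by (simp del: act.simps add: nf_mult_gen)
qed (simp add: nf_one max_norm_Nil)

text \<open>Greedy descent: multiply by a generator that lowers the norm until the trivial state is
  reached; the inverses of these generators spell \<open>g\<close>.\<close>

lemma ex_word_max_norm:
  "\<exists>gs. int (length gs) \<le> max_norm (nf g) \<and> set gs \<subseteq> B3_gens \<and> B3_prod gs = g"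
proof (induction "nat (max_norm (nf g))" arbitrary: g rule: less_induct)
  case less
  show ?case
  proof (cases "nf g = ([], 0)")
    case True
    then have "g = \<one>\<^bsub>B3\<^esub>" using state_braid_nf[of g] state_braid_nf[of "\<one>\<^bsub>B3\<^esub>"] by (simp add: nf_one)
    then show ?thesis using True by (intro exI[of _ "[]"]) (simp add: max_norm_Nil)
  next
    case False
    then obtain x where x: "max_norm (act (nf g) x) < max_norm (nf g)"
      using ex_max_norm_act_less by blast
    define h where "h = g \<otimes>\<^bsub>B3\<^esub> braid_gen x"
    have h: "max_norm (nf h) < max_norm (nf g)" using x by (simp only: h_def nf_mult_gen)
    then have "nat (max_norm (nf h)) < nat (max_norm (nf g))"
      using max_norm_nonneg[of "nf h"] by simp
    from less[OF this] obtain gs where gs: "int (length gs) \<le> max_norm (nf h)" "set gs \<subseteq> B3_gens" "B3_prod gs = h"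
      by blast
    have "B3_prod (gs @ [braid_gen (letter_inv x)]) = g"
      by (simp add: gs h_def B3.m_assoc braid_gen_mult_inv)
    then show ?thesis
      using gs h by (intro exI[of _ "gs @ [braid_gen (letter_inv x)]"]) (simp add: B3_gens_eq)
  qed
qed

lemma word_length_eq: "int (word_length g) = max_norm (nf g)"
proof -
  obtain gs where gs: "int (length gs) \<le> max_norm (nf g)" "set gs \<subseteq> B3_gens" "B3_prod gs = g"
    using ex_word_max_norm by blast
  have "word_length g = length gs"
    unfolding word_length_def
  proof (rule Least_equality)
    fix n assume "\<exists>hs. length hs = n \<and> set hs \<subseteq> B3_gens \<and> B3_prod hs = g"
    then show "length gs \<le> n" using max_norm_le_length gs(1) by fastforce
  qed (use gs in auto)
  then show ?thesis using gs max_norm_le_length[of gs] by simp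
qed

section \<open>Law of large numbers\<close>

instance letter :: countable
  by countable_datatype

text \<open>Countability makes multiplication measurable and identifies the product of discrete
  \<sigma>-algebras with the discrete one.\<close>

instance braid3 :: countable
proof (rule countable_classI)
  show "to_nat (rep_braid3 g) = to_nat (rep_braid3 h) \<Longrightarrow> g = h" for g h
    by (metis Quotient3_abs_rep Quotient3_braid3 to_nat_split)
qed

lemma walk_cong:
  "(\<And>i. i \<in> {1..n} \<Longrightarrow> x i \<omega> = y i \<eta>) \<Longrightarrow> walk x n \<omega> = walk y n \<eta>"
  by (induction n) auto

lemma measurable_braid3_mult [measurable (raw)]:
  assumes "g \<in> measurable N (count_space UNIV)" "h \<in> measurable N (count_space UNIV)"
  shows "(\<lambda>\<omega>. g \<omega> \<otimes>\<^bsub>B3\<^esub> h \<omega>) \<in> measurable N (count_space UNIV)"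
  by (rule measurable_compose_countable[OF _ assms(1)])
     (rule measurable_compose[OF assms(2)], simp)

lemma measurable_walk:
  assumes "\<And>i. i \<in> {1..n} \<Longrightarrow> x i \<in> measurable N (count_space UNIV)"
  shows "walk x n \<in> measurable N (count_space UNIV)"
  using assms
proof (induction n)
  case 0
  have "walk x 0 = (\<lambda>_. \<one>\<^bsub>B3\<^esub>)" by (simp add: fun_eq_iff)
  then show ?case by simp
next
  case (Suc n)
  have "walk x (Suc n) = (\<lambda>\<omega>. walk x n \<omega> \<otimes>\<^bsub>B3\<^esub> x (Suc n) \<omega>)" by (simp add: fun_eq_iff)
  then show ?case using Suc by (auto intro!: measurable_braid3_mult)
qed

context
  fixes M :: "'w measure" and \<nu> :: "braid3 pmf" and x :: "nat \<Rightarrow> 'w \<Rightarrow> braid3"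
  assumes steps: "iid_steps M \<nu> x"
begin

interpretation prob_space M
  using steps by (simp add: iid_steps_def)

lemma step_measurable: "i \<ge> 1 \<Longrightarrow> x i \<in> measurable M (count_space UNIV)"
  using steps by (auto simp: iid_steps_def indep_vars_def)

lemma walk_measurable [measurable]: "walk x n \<in> measurable M (count_space UNIV)"
  by (rule measurable_walk) (simp add: step_measurable)

lemma indep_walk_step:
  "indep_var (count_space UNIV) (walk x n) (count_space UNIV) (x (Suc n))"
proof -
  let ?S = "\<lambda>_. count_space UNIV :: braid3 measure"
  have "indep_var (PiM {1..n} ?S) (\<lambda>\<omega>. restrict (\<lambda>i. x i \<omega>) {1..n})
      (PiM {Suc n} ?S) (\<lambda>\<omega>. restrict (\<lambda>i. x i \<omega>) {Suc n})"
    using steps by (intro indep_var_restrict[where I = "{1..}"]) (auto simp: iid_steps_def)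
  \<comment> \<open>Running \<open>walk\<close> on the coordinate maps exhibits the position at time
    \<open>n\<close> as a measurable function of the block of the first \<open>n\<close>
    steps.\<close>
  then have "indep_var (count_space UNIV) (walk (\<lambda>i y. y i) n \<circ> (\<lambda>\<omega>. restrict (\<lambda>i. x i \<omega>) {1..n}))
      (count_space UNIV) ((\<lambda>y. y (Suc n)) \<circ> (\<lambda>\<omega>. restrict (\<lambda>i. x i \<omega>) {Suc n}))"
    by (rule indep_var_compose) (auto intro!: measurable_walk measurable_component_singleton)
  also have "walk (\<lambda>i y. y i) n \<circ> (\<lambda>\<omega>. restrict (\<lambda>i. x i \<omega>) {1..n}) = walk x n"
    by (auto simp: fun_eq_iff intro!: walk_cong)
  also have "(\<lambda>y. y (Suc n)) \<circ> (\<lambda>\<omega>. restrict (\<lambda>i. x i \<omega>) {Suc n}) = x (Suc n)"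
    by (auto simp: fun_eq_iff)
  finally show ?thesis .
qed

text \<open>One-step Markov property in integrated form: independence makes the joint law of
  position and next step a product, and Tonelli integrates the step first.\<close>

lemma nn_integral_walk_Suc:
  fixes f :: "braid3 \<Rightarrow> ennreal"
  shows "(\<integral>\<^sup>+\<omega>. f (walk x (Suc n) \<omega>) \<partial>M) = (\<integral>\<^sup>+\<omega>. \<integral>\<^sup>+s. f (walk x n \<omega> \<otimes>\<^bsub>B3\<^esub> s) \<partial>\<nu> \<partial>M)"
proof -
  let ?S = "count_space UNIV :: braid3 measure"
  let ?W = "distr M ?S (walk x n)"
  have \<nu>: "distr M ?S (x (Suc n)) = measure_pmf \<nu>"
    using steps by (simp add: iid_steps_def)
  have joint: "?W \<Otimes>\<^sub>M measure_pmf \<nu> = distr M (?S \<Otimes>\<^sub>M ?S) (\<lambda>\<omega>. (walk x n \<omega>, x (Suc n) \<omega>))"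
    using indep_walk_step[of n] unfolding indep_var_distribution_eq \<nu> by simp
  have [measurable]: "(\<lambda>(g, s). f (g \<otimes>\<^bsub>B3\<^esub> s)) \<in> borel_measurable (?S \<Otimes>\<^sub>M ?S)"
    by (simp add: pair_measure_countable)
  have [measurable]: "x (Suc n) \<in> measurable M ?S"
    by (simp add: step_measurable)
  have "(\<integral>\<^sup>+\<omega>. f (walk x (Suc n) \<omega>) \<partial>M) =
      (\<integral>\<^sup>+z. (case z of (g, s) \<Rightarrow> f (g \<otimes>\<^bsub>B3\<^esub> s)) \<partial>(?W \<Otimes>\<^sub>M measure_pmf \<nu>))"
    unfolding joint by (subst nn_integral_distr) simp_all
  also have "\<dots> = (\<integral>\<^sup>+g. \<integral>\<^sup>+s. f (g \<otimes>\<^bsub>B3\<^esub> s) \<partial>\<nu> \<partial>?W)"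
  proof (subst measure_pmf.nn_integral_fst[symmetric])
    have "sets (?W \<Otimes>\<^sub>M measure_pmf \<nu>) = sets (?S \<Otimes>\<^sub>M ?S)"
      by (intro sets_pair_measure_cong) simp_all
    then show "(\<lambda>(g, s). f (g \<otimes>\<^bsub>B3\<^esub> s)) \<in> borel_measurable (?W \<Otimes>\<^sub>M measure_pmf \<nu>)"
      by (simp cong: measurable_cong_sets)
  qed simp
  also have "\<dots> = (\<integral>\<^sup>+\<omega>. \<integral>\<^sup>+s. f (walk x n \<omega> \<otimes>\<^bsub>B3\<^esub> s) \<partial>\<nu> \<partial>M)"
    by (subst nn_integral_distr) simp_all
  finally show ?thesis .
qed

section \<open>Concentration for functions with bounded centred increments\<close>

context
  fixes F :: "braid3 \<Rightarrow> real" and c K :: real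
  assumes bounded: "\<And>g s. s \<in> set_pmf \<nu> \<Longrightarrow> \<bar>F (g \<otimes>\<^bsub>B3\<^esub> s) - F g - c\<bar> \<le> K"
    and mean: "\<And>g. measure_pmf.expectation \<nu> (\<lambda>s. F (g \<otimes>\<^bsub>B3\<^esub> s) - F g - c) = 0"
begin

text \<open>By Hoeffding's lemma, a centred increment in an interval of length \<open>2 * K\<close>
  costs a factor \<open>exp (l\<^sup>2 * K\<^sup>2 / 2)\<close> whatever the current position; the
  factors multiply along the walk.\<close>

lemma nn_integral_exp_walk_le:
  assumes "l > 0"
  shows "(\<integral>\<^sup>+\<omega>. exp (l * (F (walk x n \<omega>) - F \<one>\<^bsub>B3\<^esub> - real n * c)) \<partial>M) \<le> exp (real n * (l\<^sup>2 * K\<^sup>2 / 2))"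
proof (induction n)
  case 0
  show ?case by (simp add: emeasure_space_1)
next
  case (Suc n)
  let ?E = "\<lambda>n g. exp (l * (F g - F \<one>\<^bsub>B3\<^esub> - real n * c))"
  let ?e = "exp (l\<^sup>2 * K\<^sup>2 / 2)"
  have step: "(\<integral>\<^sup>+s. ?E (Suc n) (g \<otimes>\<^bsub>B3\<^esub> s) \<partial>\<nu>) \<le> ennreal ?e * ?E n g" for g
  proof -
    interpret interval_bounded_random_variable "measure_pmf \<nu>" "\<lambda>s. F (g \<otimes>\<^bsub>B3\<^esub> s) - F g - c" "- K" K
      by unfold_locales (auto simp: AE_measure_pmf_iff abs_le_iff dest: bounded[of _ g])
    have "?E (Suc n) (g \<otimes>\<^bsub>B3\<^esub> s) = ?E n g * exp (l * (F (g \<otimes>\<^bsub>B3\<^esub> s) - F g - c))" for s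
      by (simp add: algebra_simps flip: exp_add)
    then have "(\<integral>\<^sup>+s. ?E (Suc n) (g \<otimes>\<^bsub>B3\<^esub> s) \<partial>\<nu>) =
        ennreal (?E n g) * (\<integral>\<^sup>+s. exp (l * (F (g \<otimes>\<^bsub>B3\<^esub> s) - F g - c)) \<partial>\<nu>)"
      by (simp add: ennreal_mult nn_integral_cmult)
    also have "\<dots> \<le> ennreal (?E n g) * ?e"
      using Hoeffdings_lemma_nn_integral_0[OF assms mean[of g]]
      by (intro mult_left_mono) (simp_all add: power_mult_distrib mult.commute)
    finally show ?thesis by (simp add: mult.commute)
  qed
  have "(\<integral>\<^sup>+\<omega>. ?E (Suc n) (walk x (Suc n) \<omega>) \<partial>M) =
      (\<integral>\<^sup>+\<omega>. \<integral>\<^sup>+s. ?E (Suc n) (walk x n \<omega> \<otimes>\<^bsub>B3\<^esub> s) \<partial>\<nu> \<partial>M)"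
    by (rule nn_integral_walk_Suc)
  also have "\<dots> \<le> (\<integral>\<^sup>+\<omega>. ennreal ?e * ?E n (walk x n \<omega>) \<partial>M)"
    by (intro nn_integral_mono step)
  also have "\<dots> = ennreal ?e * (\<integral>\<^sup>+\<omega>. ?E n (walk x n \<omega>) \<partial>M)"
    by (intro nn_integral_cmult) (rule measurable_compose[OF walk_measurable], simp)
  also have "\<dots> \<le> ennreal ?e * exp (real n * (l\<^sup>2 * K\<^sup>2 / 2))"
    by (intro mult_left_mono Suc) simp
  also have "\<dots> = exp (real (Suc n) * (l\<^sup>2 * K\<^sup>2 / 2))"
    by (simp add: algebra_simps flip: ennreal_mult exp_add)
  finally show ?case .
qed

lemma prob_walk_ge_le:
  assumes "\<epsilon> > 0" "K > 0"
  shows "prob {\<omega> \<in> space M. F (walk x n \<omega>) - F \<one>\<^bsub>B3\<^esub> - real n * c \<ge> real n * \<epsilon>} \<le> exp (- (\<epsilon>\<^sup>2 / (2 * K\<^sup>2))) ^ n"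
    (is "prob ?A \<le> _")
proof -
  \<comment> \<open>The minimiser of the Chernoff exponent
    \<open>l\<^sup>2 * K\<^sup>2 / 2 - l * \<epsilon>\<close>.\<close>
  define l where "l = \<epsilon> / K\<^sup>2"
  have l: "l > 0" using assms by (simp add: l_def)
  let ?Y = "\<lambda>\<omega>. F (walk x n \<omega>) - F \<one>\<^bsub>B3\<^esub> - real n * c"
  have Y [measurable]: "?Y \<in> borel_measurable M"
    by (rule measurable_compose[OF walk_measurable]) simp
  have A: "?A \<in> sets M" by measurable
  have "ennreal (exp (l * (real n * \<epsilon>))) * emeasure M ?A = (\<integral>\<^sup>+\<omega>. exp (l * (real n * \<epsilon>)) * indicator ?A \<omega> \<partial>M)"
    using A by (simp add: nn_integral_cmult_indicator ennreal_mult ennreal_indicator)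
  also have "\<dots> \<le> (\<integral>\<^sup>+\<omega>. exp (l * ?Y \<omega>) \<partial>M)"
    using l by (intro nn_integral_mono) (auto simp: indicator_def)
  also have "\<dots> \<le> exp (real n * (l\<^sup>2 * K\<^sup>2 / 2))"
    by (rule nn_integral_exp_walk_le[OF l])
  finally have "exp (l * (real n * \<epsilon>)) * prob ?A \<le> exp (real n * (l\<^sup>2 * K\<^sup>2 / 2))"
    by (simp add: emeasure_eq_measure flip: ennreal_mult)
  then have "prob ?A \<le> exp (real n * (l\<^sup>2 * K\<^sup>2 / 2) - l * (real n * \<epsilon>))"
    by (simp add: exp_diff pos_le_divide_eq mult.commute)
  also have "real n * (l\<^sup>2 * K\<^sup>2 / 2) - l * (real n * \<epsilon>) = real n * - (\<epsilon>\<^sup>2 / (2 * K\<^sup>2))"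
    using assms by (simp add: l_def field_simps power2_eq_square)
  finally show ?thesis by (simp only: exp_of_nat_mult)
qed

lemma AE_eventually_walk_less:
  assumes "\<epsilon> > 0" "K > 0"
  shows "AE \<omega> in M. \<forall>\<^sub>F n in sequentially. F (walk x n \<omega>) - F \<one>\<^bsub>B3\<^esub> - real n * c < real n * \<epsilon>"
proof -
  let ?A = "\<lambda>n. {\<omega> \<in> space M. F (walk x n \<omega>) - F \<one>\<^bsub>B3\<^esub> - real n * c \<ge> real n * \<epsilon>}"
  have [measurable]: "(\<lambda>\<omega>. F (walk x n \<omega>)) \<in> borel_measurable M" for n
    by (rule measurable_compose[OF walk_measurable]) simp
  have "AE \<omega> in M. \<forall>\<^sub>F n in sequentially. \<omega> \<in> space M - ?A n"
  proof (rule borel_cantelli_AE1)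
    show "?A n \<in> sets M" for n by measurable
    show "emeasure M (?A n) < \<infinity>" for n by (simp add: emeasure_eq_measure)
    have "exp (- (\<epsilon>\<^sup>2 / (2 * K\<^sup>2))) < 1" using assms by simp
    then show "summable (\<lambda>n. prob (?A n))"
      using prob_walk_ge_le[OF assms]
      by (intro summable_comparison_test'[OF summable_geometric[of "exp (- (\<epsilon>\<^sup>2 / (2 * K\<^sup>2)))"]]) auto
  qed
  then show ?thesis
    by eventually_elim (auto elim: eventually_mono)
qed

end

lemma has_drift_martingale:
  assumes bounded: "\<And>g s. s \<in> set_pmf \<nu> \<Longrightarrow> \<bar>F (g \<otimes>\<^bsub>B3\<^esub> s) - F g\<bar> \<le> K"
    and mean: "\<And>g. measure_pmf.expectation \<nu> (\<lambda>s. F (g \<otimes>\<^bsub>B3\<^esub> s)) = F g + c"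
  shows "has_drift M x F c"
proof -
  \<comment> \<open>Subtracting \<open>c\<close> costs at most \<open>\<bar>c\<bar>\<close>; the
    added 1 makes the bound positive, as the tail estimate requires.\<close>
  define K' where "K' = \<bar>K\<bar> + \<bar>c\<bar> + 1"
  have K': "K' > 0" by (simp add: K'_def)
  have int: "integrable (measure_pmf \<nu>) (\<lambda>s. F (g \<otimes>\<^bsub>B3\<^esub> s))" for g
  proof (rule measure_pmf.integrable_const_bound)
    show "AE s in measure_pmf \<nu>. norm (F (g \<otimes>\<^bsub>B3\<^esub> s)) \<le> \<bar>F g\<bar> + K"
      using bounded[of _ g] by (fastforce simp: AE_measure_pmf_iff)
  qed simp
  have up: "AE \<omega> in M. \<forall>\<^sub>F n in sequentially. F (walk x n \<omega>) - F \<one>\<^bsub>B3\<^esub> - real n * c < real n * \<epsilon>"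
    if "\<epsilon> > 0" for \<epsilon>
  proof (rule AE_eventually_walk_less[OF _ _ that K'])
    show "\<bar>F (g \<otimes>\<^bsub>B3\<^esub> s) - F g - c\<bar> \<le> K'" if "s \<in> set_pmf \<nu>" for g s
      using bounded[OF that, of g] by (simp add: K'_def)
    show "measure_pmf.expectation \<nu> (\<lambda>s. F (g \<otimes>\<^bsub>B3\<^esub> s) - F g - c) = 0" for g
      by (simp add: Bochner_Integration.integral_diff int mean)
  qed
  \<comment> \<open>The lower deviation is the upper one for \<open>- F\<close> and
    \<open>- c\<close>.\<close>
  have dn: "AE \<omega> in M. \<forall>\<^sub>F n in sequentially. - F (walk x n \<omega>) - - F \<one>\<^bsub>B3\<^esub> - real n * - c < real n * \<epsilon>"
    if "\<epsilon> > 0" for \<epsilon>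
  proof (rule AE_eventually_walk_less[OF _ _ that K'])
    show "\<bar>- F (g \<otimes>\<^bsub>B3\<^esub> s) - - F g - - c\<bar> \<le> K'" if "s \<in> set_pmf \<nu>" for g s
      using bounded[OF that, of g] by (simp add: K'_def)
    show "measure_pmf.expectation \<nu> (\<lambda>s. - F (g \<otimes>\<^bsub>B3\<^esub> s) - - F g - - c) = 0" for g
      by (simp add: Bochner_Integration.integral_diff int mean)
  qed
  \<comment> \<open>Restricting to the tolerances \<open>1 / Suc m\<close> leaves countably many
    null sets.\<close>
  have "AE \<omega> in M. \<forall>m. \<forall>\<^sub>F n in sequentially. \<bar>F (walk x n \<omega>) - F \<one>\<^bsub>B3\<^esub> - real n * c\<bar> < real n * (1 / Suc m)"
    unfolding AE_all_countable
  proof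
    fix m
    show "AE \<omega> in M. \<forall>\<^sub>F n in sequentially. \<bar>F (walk x n \<omega>) - F \<one>\<^bsub>B3\<^esub> - real n * c\<bar> < real n * (1 / Suc m)"
      using up[of "1 / Suc m", simplified] dn[of "1 / Suc m", simplified] 
    proof eventually_elim
      case (elim \<omega>)
      then show ?case by eventually_elim auto
    qed
  qed
  then show ?thesis
    unfolding has_drift_def
  proof eventually_elim
    case (elim \<omega>)
    have "(\<lambda>n. (F (walk x n \<omega>) - F \<one>\<^bsub>B3\<^esub> - real n * c) / real n) \<longlonglongrightarrow> 0"
    proof (rule tendstoI)
      fix e :: real assume "e > 0"
      then obtain m where m: "1 / real (Suc m) < e" using nat_approx_posE by blast
      show "\<forall>\<^sub>F n in sequentially. dist ((F (walk x n \<omega>) - F \<one>\<^bsub>B3\<^esub> - real n * c) / real n) 0 < e"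
        using elim[rule_format, of m] eventually_gt_at_top[of 0]
      proof eventually_elim
        case (elim n)
        then have "\<bar>F (walk x n \<omega>) - F \<one>\<^bsub>B3\<^esub> - real n * c\<bar> / real n < 1 / Suc m"
          by (simp add: field_simps)
        then show ?case using m by (simp add: dist_real_def)
      qed
    qed
    moreover have "(\<lambda>n. F \<one>\<^bsub>B3\<^esub> / real n + c) \<longlonglongrightarrow> 0 + c"
      by (intro tendsto_intros lim_const_over_n)
    ultimately have "(\<lambda>n. (F (walk x n \<omega>) - F \<one>\<^bsub>B3\<^esub> - real n * c) / real n + (F \<one>\<^bsub>B3\<^esub> / real n + c)) \<longlonglongrightarrow> 0 + (0 + c)"
      by (rule tendsto_add)
    moreover have "\<forall>\<^sub>F n in sequentially. (F (walk x n \<omega>) - F \<one>\<^bsub>B3\<^esub> - real n * c) / real n +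
        (F \<one>\<^bsub>B3\<^esub> / real n + c) = F (walk x n \<omega>) / real n"
      using eventually_gt_at_top[of 0] by eventually_elim (simp add: field_simps)
    ultimately show ?case
      using Lim_transform_eventually by fastforce
  qed
qed

end

text \<open>Serves to discard the bounded corrector once the drift of the martingale is
  known.\<close>

lemma has_drift_bounded_diff:
  assumes "has_drift M x F c" "\<And>g. \<bar>G g - F g\<bar> \<le> K"
  shows "has_drift M x G c"
  using assms(1) unfolding has_drift_def
proof eventually_elim
  case (elim \<omega>)
  have "(\<lambda>n. K / real n) \<longlonglongrightarrow> 0"
    by (rule lim_const_over_n)
  then have "(\<lambda>n. (G (walk x n \<omega>) - F (walk x n \<omega>)) / real n) \<longlonglongrightarrow> 0"
    by (rule Lim_null_comparison[rotated]) (simp add: divide_right_mono assms(2))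
  from tendsto_add[OF this elim] show ?case
    by (simp flip: add_divide_distrib)
qed

section \<open>Drifts\<close>

text \<open>The root in \<open>(0, 1)\<close> of the quadratic for \<open>w\<close>, with the square
  root in the denominator so that \<open>p = 1/4\<close>, where the equation becomes linear, is no
  exception.\<close>

definition short_freq :: "real \<Rightarrow> real" where
  "short_freq p = 2 / (3 - 4 * p + sqrt (16 * p\<^sup>2 - 8 * p + 5))"

lemma sqrt_bounds:
  fixes p :: real
  defines "r \<equiv> sqrt (16 * p\<^sup>2 - 8 * p + 5)"
  shows "r\<^sup>2 = 16 * p\<^sup>2 - 8 * p + 5" "r \<ge> 2" "r > 4 * p - 1"
proof -
  have *: "16 * p\<^sup>2 - 8 * p + 5 = (4 * p - 1)\<^sup>2 + 4"
    by (simp add: power2_eq_square algebra_simps)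
  show "r\<^sup>2 = 16 * p\<^sup>2 - 8 * p + 5"
    unfolding r_def by (subst real_sqrt_pow2) (auto simp: *)
  show "r \<ge> 2"
    unfolding r_def by (rule real_le_rsqrt) (auto simp: *)
  have "sqrt ((4 * p - 1)\<^sup>2) < r"
    unfolding r_def * by (rule real_sqrt_less_mono) simp
  then show "r > 4 * p - 1" by simp
qed

text \<open>The last two facts concern \<open>p * w + (1 / 2 - p) * (1 - w)\<close>, the mean growth
  of the number of factors under the top frequencies \<open>w\<close> and \<open>1 - w\<close>. Its
  positivity later allows solving for \<open>h\<close>.\<close>

lemma short_freq_facts:
  fixes p :: real
  defines "w \<equiv> short_freq p"
  shows "0 < w" "w < 1" "(2 * p - 1 / 2) * (w - w\<^sup>2) = w - 1 / 2"
    "1 / 2 - p + (2 * p - 1 / 2) * w = (sqrt (16 * p\<^sup>2 - 8 * p + 5) - 1) / 4"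
    "1 / 2 - p + (2 * p - 1 / 2) * w > 0"
proof -
  define r where "r = sqrt (16 * p\<^sup>2 - 8 * p + 5)"
  define D where "D = 3 - 4 * p + r"
  note r = sqrt_bounds[of p, folded r_def]
  have w: "w = 2 / D" by (simp add: w_def short_freq_def D_def r_def)
  have D: "D > 2" using r by (simp add: D_def)
  show "0 < w" "w < 1" using D by (simp_all add: w)
  have wD: "w * D = 2" using D by (simp add: w)
  \<comment> \<open>The quadratic equation multiplied by \<open>2 * D\<^sup>2\<close>, with
    \<open>w * D\<close> replaced by 2.\<close>
  have "(4 * p - 1) * (D - 2) * 2 = 4 * D - D\<^sup>2"
    unfolding D_def using r(1) by algebra
  then have "D\<^sup>2 * ((2 * p - 1 / 2) * (w - w\<^sup>2)) = D\<^sup>2 * (w - 1 / 2)"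
    using wD by algebra
  then show "(2 * p - 1 / 2) * (w - w\<^sup>2) = w - 1 / 2"
    using D by simp
  have "(2 - 4 * p) * D + 4 * (4 * p - 1) = (r - 1) * D"
    unfolding D_def using r(1) by algebra
  then have *: "1 / 2 - p + (2 * p - 1 / 2) * w = (r - 1) / 4"
    using D by (simp add: w field_simps)
  then show "1 / 2 - p + (2 * p - 1 / 2) * w = (sqrt (16 * p\<^sup>2 - 8 * p + 5) - 1) / 4"
    by (simp only: r_def)
  show "1 / 2 - p + (2 * p - 1 / 2) * w > 0"
    unfolding * using r(2) by simp
qed

text \<open>
  \<open>1 - w\<close> and \<open>w\<close> are the probabilities that a top symbol \<open>1\<close> resp. \<open>2\<close> is ever popped. The value \<open>h\<close>
  at the empty stack is chosen below so that the martingale property also holds there.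
\<close>
fun corrector :: "real \<Rightarrow> real \<Rightarrow> real \<Rightarrow> simple_elt list \<Rightarrow> real" where
  "corrector w \<beta> h [] = h"
| "corrector w \<beta> h ((f, d) # ts) =
     (if d then w * corrector w \<beta> h ts else w * (2 * \<beta>) + (1 - w) * corrector w \<beta> h ts)"

text \<open>Each factor replaces the value by a convex combination of itself with 0 or with
  \<open>2 * \<beta>\<close>.\<close>

lemma corrector_bounded:
  assumes "0 < w" "w < 1"
  shows "\<bar>corrector w \<beta> h ts\<bar> \<le> 2 * \<bar>\<beta>\<bar> + \<bar>h\<bar>"
proof (induction ts)
  case (Cons t ts)
  let ?B = "2 * \<bar>\<beta>\<bar> + \<bar>h\<bar>"
  obtain f d where t: "t = (f, d)" by fastforce
  have *: "w * \<bar>corrector w \<beta> h ts\<bar> \<le> w * ?B" "(1 - w) * \<bar>corrector w \<beta> h ts\<bar> \<le> (1 - w) * ?B"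
    using Cons assms by (auto intro: mult_left_mono)
  show ?case
  proof (cases d)
    case True
    have "w * ?B \<le> 1 * ?B" using assms by (intro mult_right_mono) auto
    with *(1) have "w * \<bar>corrector w \<beta> h ts\<bar> \<le> 1 * ?B" by (rule order_trans)
    then show ?thesis using True assms by (simp add: t abs_mult)
  next
    case False
    have "\<bar>w * (2 * \<beta>) + (1 - w) * corrector w \<beta> h ts\<bar>
        \<le> \<bar>w * (2 * \<beta>)\<bar> + \<bar>(1 - w) * corrector w \<beta> h ts\<bar>"
      by (rule abs_triangle_ineq)
    also have "\<dots> = w * (2 * \<bar>\<beta>\<bar>) + (1 - w) * \<bar>corrector w \<beta> h ts\<bar>"
      using assms by (simp add: abs_mult)
    also have "\<dots> \<le> w * ?B + (1 - w) * ?B"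
      using assms by (intro add_mono mult_left_mono Cons) auto
    also have "\<dots> = ?B" by (simp add: algebra_simps)
    finally show ?thesis using False by (simp add: t)
  qed
qed simp

section \<open>One-step means of linear functions and of the corrector\<close>

text \<open>The coefficient \<open>t\<close> belongs to the image in the abelianization, whose mean
  increment is \<open>4 * p - 1\<close> in every state. The number of letters is the case
  \<open>v = - 3\<close>, \<open>t = 1\<close>.\<close>

fun linear_fun :: "real \<Rightarrow> real \<Rightarrow> real \<Rightarrow> garside_state \<Rightarrow> real" where
  "linear_fun u v t (ts, k) =
     u * real (length ts) + v * real_of_int k + t * (real (count_letters ts) + 3 * real_of_int k)"

lemma linear_fun_mult_le:
  "\<bar>linear_fun u v t (mult_pos c s) - linear_fun u v t s\<bar> \<le> \<bar>u\<bar> + \<bar>v\<bar> + \<bar>t\<bar>"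
  "\<bar>linear_fun u v t (mult_neg c s) - linear_fun u v t s\<bar> \<le> \<bar>u\<bar> + \<bar>v\<bar> + \<bar>t\<bar>"
  by (cases "(c, s)" rule: mult_pos.cases; auto simp: algebra_simps abs_if)+

text \<open>The parity swap in \<open>act\<close> only exchanges two equally likely letters, so it
  does not appear here.\<close>

definition step_mean :: "real \<Rightarrow> (garside_state \<Rightarrow> real) \<Rightarrow> garside_state \<Rightarrow> real" where
  "step_mean p F s = p * (F (mult_pos True s) + F (mult_pos False s))
     + (1 / 2 - p) * (F (mult_neg True s) + F (mult_neg False s))"

lemma step_mean_add: "step_mean p (\<lambda>s. F s + G s) s = step_mean p F s + step_mean p G s"
  by (simp add: step_mean_def algebra_simps)

lemma step_mean_linear_fun:
  "step_mean p (linear_fun u v t) ([], k) =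
     linear_fun u v t ([], k) + u - (1 - 2 * p) * v + t * (4 * p - 1)"
  "step_mean p (linear_fun u v t) ((f, d) # ts, k) =
     linear_fun u v t ((f, d) # ts, k) + t * (4 * p - 1) +
     (if d then u * (1 / 2 - p) + v * (2 * p - 1 / 2) else u * p - v * (1 / 2 - p))"
  by (cases f; cases d; simp add: step_mean_def algebra_simps)+

text \<open>The quadratic equation makes the mean increment at a nonempty stack depend only on the
  top. The two values average to zero under the weights \<open>1 - w\<close> and \<open>w\<close> of
  a two-letter and a one-letter top.\<close>

lemma step_mean_corrector:
  assumes w: "(2 * p - 1 / 2) * (w - w\<^sup>2) = w - 1 / 2"
  shows "step_mean p (\<lambda>s. corrector w \<beta> h (fst s)) ([], k) =
      h + 4 * p * w * \<beta> - 2 * (1 / 2 - p + (2 * p - 1 / 2) * w) * h"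
    "step_mean p (\<lambda>s. corrector w \<beta> h (fst s)) ((f, d) # ts, k) =
      corrector w \<beta> h ((f, d) # ts) + (if d then w * \<beta> else - (1 - w) * \<beta>)"
proof -
  show "step_mean p (\<lambda>s. corrector w \<beta> h (fst s)) ([], k) =
      h + 4 * p * w * \<beta> - 2 * (1 / 2 - p + (2 * p - 1 / 2) * w) * h"
    by (simp add: step_mean_def algebra_simps)
  define g where "g = corrector w \<beta> h ts"
  have long: "p * ((w * (2 * \<beta>) + (1 - w) * (w * g)) + g)
      + (1 / 2 - p) * ((w * (2 * \<beta>) + (1 - w) * g) + w * (w * g)) = w * g + w * \<beta>"
    using w by algebra
  have short: "p * ((w * (2 * \<beta>) + (1 - w) * (w * (2 * \<beta>) + (1 - w) * g)) + w * g)
      + (1 / 2 - p) * (g + w * (w * (2 * \<beta>) + (1 - w) * g))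
      = (w * (2 * \<beta>) + (1 - w) * g) + - (1 - w) * \<beta>"
    using w by algebra
  show "step_mean p (\<lambda>s. corrector w \<beta> h (fst s)) ((f, d) # ts, k) =
      corrector w \<beta> h ((f, d) # ts) + (if d then w * \<beta> else - (1 - w) * \<beta>)"
    using long short
    by (cases f; cases d; simp add: step_mean_def flip: g_def; simp add: add.commute)
qed

text \<open>\<open>\<beta>\<close> is the mean increment of the linear function at a one-letter top
  minus that at a two-letter top, and \<open>c\<close> is their average with weights
  \<open>w\<close> and \<open>1 - w\<close>. The corrector levels both to \<open>c\<close>, and the
  equation for \<open>h\<close> does so at the empty stack.\<close>

lemma step_mean_corrected:
  assumes w: "(2 * p - 1 / 2) * (w - w\<^sup>2) = w - 1 / 2"
    and \<beta>: "\<beta> = u * (2 * p - 1 / 2) - v * p"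
    and c: "c = u * (1 / 2 - p + (2 * p - 1 / 2) * w) + v * (2 * p - 1 / 2 - p * w) + t * (4 * p - 1)"
    and h: "2 * (1 / 2 - p + (2 * p - 1 / 2) * w) * h = u - (1 - 2 * p) * v + t * (4 * p - 1) + 4 * p * w * \<beta> - c"
  shows "step_mean p (\<lambda>s. linear_fun u v t s + corrector w \<beta> h (fst s)) s =
    linear_fun u v t s + corrector w \<beta> h (fst s) + c"
  unfolding step_mean_add
proof (cases s)
  case (Pair ts k)
  show "step_mean p (linear_fun u v t) s + step_mean p (\<lambda>s. corrector w \<beta> h (fst s)) s =
    linear_fun u v t s + corrector w \<beta> h (fst s) + c"
  proof (cases ts)
    case Nil
    then show ?thesis using h unfolding Pair
      by (simp only: step_mean_linear_fun step_mean_corrector[OF w]) simp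
  next
    case (Cons x us)
    obtain f d where "x = (f, d)" by fastforce
    then show ?thesis unfolding Pair Cons c \<beta>
      by (simp only: step_mean_linear_fun step_mean_corrector[OF w] fst_conv)
        (cases d; simp add: field_simps)
  qed
qed

section \<open>Drifts of the given walk\<close>

locale symmetric_walk =
  fixes p :: real and \<nu> :: "braid3 pmf"
    and M :: "'w measure" and x :: "nat \<Rightarrow> 'w \<Rightarrow> braid3"
  assumes p: "0 < p" "p < 1/2"
    and \<nu>_supp: "set_pmf \<nu> \<subseteq> B3_gens"
    and \<nu>_pos: "pmf \<nu> gen_a = p" "pmf \<nu> gen_b = p"
    and \<nu>_neg: "pmf \<nu> (inv\<^bsub>B3\<^esub> gen_a) = 1/2 - p" "pmf \<nu> (inv\<^bsub>B3\<^esub> gen_b) = 1/2 - p"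
    and steps: "iid_steps M \<nu> x"
begin

lemma expectation_step:
  "measure_pmf.expectation \<nu> (\<lambda>s. F (nf (g \<otimes>\<^bsub>B3\<^esub> s))) = step_mean p F (nf g)"
proof -
  have "measure_pmf.expectation \<nu> (\<lambda>s. F (nf (g \<otimes>\<^bsub>B3\<^esub> s))) =
      (\<Sum>s\<in>B3_gens. F (nf (g \<otimes>\<^bsub>B3\<^esub> s)) * pmf \<nu> s)"
    using \<nu>_supp by (intro integral_measure_pmf_real) (auto simp: B3_gens_def)
  also have "\<dots> = (\<Sum>y\<in>UNIV. F (act (nf g) y) * pmf \<nu> (braid_gen y))"
    unfolding B3_gens_eq by (simp add: sum.reindex inj_braid_gen nf_mult_gen del: act.simps)
  also have "\<dots> = step_mean p F (nf g)"
    by (cases "odd (snd (nf g))")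
      (simp_all add: UNIV_letter braid_gen_simps \<nu>_pos \<nu>_neg step_mean_def algebra_simps)
  finally show ?thesis .
qed

lemma has_drift_linear_fun:
  "has_drift M x (\<lambda>g. linear_fun u v t (nf g))
     (u * ((sqrt (16 * p\<^sup>2 - 8 * p + 5) - 1) / 4) + v * (2 * p - 1 / 2 - p * short_freq p) + t * (4 * p - 1))"
    (is "has_drift M x _ ?c")
proof -
  define w where "w = short_freq p"
  note w = short_freq_facts[of p, folded w_def]
  define \<beta> where "\<beta> = u * (2 * p - 1 / 2) - v * p"
  \<comment> \<open>The value at the empty stack solves a linear equation whose coefficient is the
    positive growth rate of the number of factors.\<close>
  have "\<exists>h. 2 * m * h = b" if "m > 0" for m b :: real
    using that by (intro exI[of _ "b / (2 * m)"]) simp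
  from this[OF w(5)] obtain h where h: "2 * (1 / 2 - p + (2 * p - 1 / 2) * w) * h =
      u - (1 - 2 * p) * v + t * (4 * p - 1) + 4 * p * w * \<beta> - ?c" ..
  let ?B = "2 * \<bar>\<beta>\<bar> + \<bar>h\<bar>"
  let ?F = "\<lambda>s. linear_fun u v t s + corrector w \<beta> h (fst s)"
  note B = corrector_bounded[OF w(1,2), of \<beta> h]
  have "has_drift M x (\<lambda>g. ?F (nf g)) ?c"
  proof (rule has_drift_martingale[OF steps, where F = "\<lambda>g. ?F (nf g)"])
    fix g s assume "s \<in> set_pmf \<nu>"
    then obtain y where s: "s = braid_gen y" using \<nu>_supp by (auto simp: B3_gens_eq)
    have "\<bar>linear_fun u v t (act (nf g) y) - linear_fun u v t (nf g)\<bar> \<le> \<bar>u\<bar> + \<bar>v\<bar> + \<bar>t\<bar>"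
      using linear_fun_mult_le by (cases y) simp_all
    moreover have "\<bar>(a' + b') - (a + b)\<bar> \<le> K + 2 * B"
      if "\<bar>a' - a\<bar> \<le> K" "\<bar>b'\<bar> \<le> B" "\<bar>b\<bar> \<le> B" for a a' b b' K B :: real
      using that by linarith
    ultimately show "\<bar>?F (nf (g \<otimes>\<^bsub>B3\<^esub> s)) - ?F (nf g)\<bar> \<le> \<bar>u\<bar> + \<bar>v\<bar> + \<bar>t\<bar> + 2 * ?B"
      using B unfolding s nf_mult_gen by blast
  next
    fix g
    have "measure_pmf.expectation \<nu> (\<lambda>s. ?F (nf (g \<otimes>\<^bsub>B3\<^esub> s))) = step_mean p ?F (nf g)"
      by (rule expectation_step)
    also have "\<dots> = ?F (nf g) + ?c"
      by (rule step_mean_corrected[OF w(3) \<beta>_def _ h]) (unfold w(4), unfold w_def, rule refl)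
    finally show "measure_pmf.expectation \<nu> (\<lambda>s. ?F (nf (g \<otimes>\<^bsub>B3\<^esub> s))) = ?F (nf g) + ?c" .
  qed
  moreover have "\<bar>linear_fun u v t (nf g) - ?F (nf g)\<bar> \<le> ?B" for g
    using B[of "fst (nf g)"] by simp
  ultimately show ?thesis by (rule has_drift_bounded_diff)
qed

lemma has_drift_linear_fun_eq:
  assumes "\<And>g. G g = linear_fun u v t (nf g)"
    and "d = u * ((sqrt (16 * p\<^sup>2 - 8 * p + 5) - 1) / 4) + v * (2 * p - 1 / 2 - p * short_freq p) + t * (4 * p - 1)"
  shows "has_drift M x G d"
proof -
  have "G = (\<lambda>g. linear_fun u v t (nf g))" using assms(1) by (rule ext)
  then show ?thesis unfolding assms(2) by (simp only: has_drift_linear_fun)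
qed

lemma has_drift_max:
  assumes "has_drift M x F c" "has_drift M x G d"
  shows "has_drift M x (\<lambda>g. max (F g) (G g)) (max c d)"
  using assms unfolding has_drift_def
proof eventually_elim
  case (elim \<omega>)
  have "max (F g) (G g) / real n = max (F g / real n) (G g / real n)" for g n
    by (simp add: max_divide_distrib_right)
  then show ?case using tendsto_max[OF elim] by simp
qed

text \<open>The drifts of the four linear functions in \<open>max_norm\<close> are known, and the
  maximum, being continuous, passes to the limit.\<close>

lemma has_drift_word_length:
  fixes e :: real
  defines "e \<equiv> 4 * p - 1" and "l \<equiv> (sqrt (16 * p\<^sup>2 - 8 * p + 5) - 1) / 4"
    and "k \<equiv> 2 * p - 1 / 2 - p * short_freq p"
  shows "has_drift M x (\<lambda>g. real (word_length g)) (Max {- e, 2 * l - e + 2 * k, e - 2 * k, e})"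
proof -
  have "real (word_length g) = max (linear_fun 0 0 1 (nf g)) (max (linear_fun 0 (- 2) 1 (nf g))
      (max (linear_fun 2 2 (- 1) (nf g)) (linear_fun 0 0 (- 1) (nf g))))" for g
  proof -
    obtain ts m where nf: "nf g = (ts, m)" by fastforce
    have "real (word_length g) = real_of_int (max_norm (nf g))"
      by (simp flip: word_length_eq)
    moreover have "max_norm (ts, m) = max (int (count_letters ts) + 3 * m) (max (int (count_letters ts) + m)
        (max (2 * int (length ts) - int (count_letters ts) - m) (- int (count_letters ts) - 3 * m)))"
      by (simp add: max_norm_def Let_def)
    ultimately show ?thesis
      unfolding nf by (simp only: of_int_max) (simp add: algebra_simps)
  qed
  moreover have "has_drift M x (\<lambda>g. max (linear_fun 0 0 1 (nf g)) (max (linear_fun 0 (- 2) 1 (nf g))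
      (max (linear_fun 2 2 (- 1) (nf g)) (linear_fun 0 0 (- 1) (nf g)))))
      (max e (max (e - 2 * k) (max (2 * l - e + 2 * k) (- e))))"
    by (intro has_drift_max has_drift_linear_fun_eq[OF refl])
      (simp_all add: e_def l_def[symmetric] k_def[symmetric])
  moreover have "{- e, 2 * l - e + 2 * k, e - 2 * k, e} = {e, e - 2 * k, 2 * l - e + 2 * k, - e}"
    by blast
  ultimately show ?thesis by simp
qed

end

section \<open>Closed formulas and their removable singularity at \<open>1/4\<close>\<close>

text \<open>The numerator factors through the denominator at every point, \<open>1/4\<close>
  included, so the continuous quotient \<open>g\<close> supplies the limit.\<close>

lemma extended_at_quarter_eq:
  assumes "isCont g (1 / 4)" "\<And>y. y \<noteq> 1 / 4 \<Longrightarrow> d y \<noteq> 0" "\<And>y. n y = g y * d y"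
  shows "extended_at_quarter (\<lambda>y. n y / d y) p = g p"
proof -
  have eq: "n y / d y = g y" if "y \<noteq> 1 / 4" for y
    using assms(2)[OF that] assms(3) by simp
  have "((\<lambda>y. n y / d y) \<longlongrightarrow> g (1 / 4)) (at (1 / 4)) \<longleftrightarrow> (g \<longlongrightarrow> g (1 / 4)) (at (1 / 4))"
    by (intro Lim_cong_within) (use eq in auto)
  then have "Lim (at (1 / 4)) (\<lambda>y. n y / d y) = g (1 / 4)"
    using assms(1) by (intro tendsto_Lim) (auto simp: isCont_def)
  then have "extended_at_quarter (\<lambda>y. n y / d y) (1 / 4) = g (1 / 4)"
    by (simp add: extended_at_quarter_def)
  moreover have "extended_at_quarter (\<lambda>y. n y / d y) p = g p" if "p \<noteq> 1 / 4"
    using that eq by (simp add: extended_at_quarter_def)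
  ultimately show ?thesis by blast
qed

lemma isCont_short_freq: "isCont short_freq p"
proof -
  have "sqrt (16 * p\<^sup>2 - 8 * p + 5) > 4 * p - 1" by (rule sqrt_bounds)
  then show ?thesis
    unfolding short_freq_def[abs_def] by (intro continuous_intros) simp
qed

text \<open>Stated without division so that it also holds at \<open>p = 1/4\<close>; the other
  closed formulas follow from it by polynomial algebra.\<close>

lemma exponent_drift_times:
  "(2 * p - 1 / 2 - p * short_freq p) * (2 * (1 - 4 * p)) =
     - (12 * p\<^sup>2 - 5 * p + 1 - p * sqrt (16 * p\<^sup>2 - 8 * p + 5))"
proof -
  define r where "r = sqrt (16 * p\<^sup>2 - 8 * p + 5)"
  define w where "w = short_freq p"
  note r = sqrt_bounds[of p, folded r_def]
  have D: "3 - 4 * p + r \<noteq> 0" using r by simp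
  have "w = 2 / (3 - 4 * p + r)"
    by (simp add: w_def short_freq_def r_def)
  then have "w * (3 - 4 * p + r) = 2"
    using nonzero_eq_divide_eq[OF D] by blast
  with r(1) have "(3 - 4 * p + r) * ((2 * p - 1 / 2 - p * w) * (2 * (1 - 4 * p)))
      = (3 - 4 * p + r) * - (12 * p\<^sup>2 - 5 * p + 1 - p * r)"
    by algebra
  then show ?thesis
    using D unfolding r_def[symmetric] w_def[symmetric] mult_cancel_left by blast
qed

theorem proposition4p5:
  fixes p :: real and \<nu> :: "braid3 pmf"
    and M :: "'w measure" and x :: "nat \<Rightarrow> 'w \<Rightarrow> braid3"
  assumes p: "0 < p" "p < 1/2"
    and \<nu>_supp: "set_pmf \<nu> \<subseteq> B3_gens"
    and \<nu>_pos: "pmf \<nu> gen_a = p" "pmf \<nu> gen_b = p"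
    and \<nu>_neg: "pmf \<nu> (inv\<^bsub>B3\<^esub> gen_a) = 1/2 - p" "pmf \<nu> (inv\<^bsub>B3\<^esub> gen_b) = 1/2 - p"
    and steps: "iid_steps M \<nu> x"
  shows "has_drift M x (\<lambda>g. real (garside_length_T g))
           ((-1 + sqrt (16 * p^2 - 8 * p + 5)) / 4)
    \<and> has_drift M x (\<lambda>g. real (garside_length_pos g))
           (extended_at_quarter
             (\<lambda>p. (4 * p^2 + p + 1 - 3 * p * sqrt (16 * p^2 - 8 * p + 5)) / (2 * (1 - 4 * p))) p)
    \<and> has_drift M x (\<lambda>g. real_of_int (garside_exponent g))
           (extended_at_quarter
             (\<lambda>p. - ((12 * p^2 - 5 * p + 1 - p * sqrt (16 * p^2 - 8 * p + 5)) / (2 * (1 - 4 * p)))) p)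
    \<and> has_drift M x (\<lambda>g. real (word_length g))
           (Max {1 - 4 * p,
                 extended_at_quarter
                   (\<lambda>p. (1 - 2 * p) * (-1 - 4 * p + sqrt (5 - 8 * p + 16 * p^2)) / (2 * (1 - 4 * p))) p,
                 extended_at_quarter
                   (\<lambda>p. p * (-3 + 4 * p + sqrt (5 - 8 * p + 16 * p^2)) / (-1 + 4 * p)) p,
                 -1 + 4 * p})"
proof -
  interpret symmetric_walk p \<nu> M x
    by unfold_locales fact+
  let ?k = "\<lambda>p. 2 * p - 1 / 2 - p * short_freq p"
  let ?r = "\<lambda>p. sqrt (16 * p\<^sup>2 - 8 * p + 5)"
  have d: "2 * (1 - 4 * y) \<noteq> 0" "-1 + 4 * y \<noteq> 0" if "y \<noteq> 1 / 4" for y :: real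
    using that by auto
  have pos: "extended_at_quarter (\<lambda>p. (4 * p\<^sup>2 + p + 1 - 3 * p * ?r p) / (2 * (1 - 4 * p))) p
      = (4 * p - 1) - 3 * ?k p"
  proof (rule extended_at_quarter_eq)
    show "4 * y\<^sup>2 + y + 1 - 3 * y * ?r y = ((4 * y - 1) - 3 * ?k y) * (2 * (1 - 4 * y))" for y
    proof -
      \<comment> \<open>With exponent drift and square root replaced by variables linked by one
        relation, a polynomial identity remains.\<close>
      have "4 * y\<^sup>2 + y + 1 - 3 * y * r = ((4 * y - 1) - 3 * k) * (2 * (1 - 4 * y))"
        if "k * (2 * (1 - 4 * y)) = - (12 * y\<^sup>2 - 5 * y + 1 - y * r)" for k r
        using that by algebra
      from this[OF exponent_drift_times[of y]] show ?thesis .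
    qed
  qed (intro continuous_intros isCont_short_freq, use d in simp)
  have ex: "extended_at_quarter (\<lambda>p. - ((12 * p\<^sup>2 - 5 * p + 1 - p * ?r p) / (2 * (1 - 4 * p)))) p = ?k p"
    \<comment> \<open>The sign moves into the numerator to match the quotient form of
      \<open>extended_at_quarter_eq\<close>.\<close>
    unfolding minus_divide_left
    by (rule extended_at_quarter_eq)
      (intro continuous_intros isCont_short_freq, use d in simp, rule exponent_drift_times[symmetric])
  have *: "5 - 8 * q + 16 * q\<^sup>2 = 16 * q\<^sup>2 - 8 * q + 5" for q :: real by simp
  have m2: "extended_at_quarter (\<lambda>p. (1 - 2 * p) * (-1 - 4 * p + sqrt (5 - 8 * p + 16 * p\<^sup>2)) / (2 * (1 - 4 * p))) p
      = 2 * ((?r p - 1) / 4) - (4 * p - 1) + 2 * ?k p"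
    unfolding *
  proof (rule extended_at_quarter_eq)
    show "(1 - 2 * y) * (-1 - 4 * y + ?r y) =
        (2 * ((?r y - 1) / 4) - (4 * y - 1) + 2 * ?k y) * (2 * (1 - 4 * y))" for y
    proof -
      have "(1 - 2 * y) * (-1 - 4 * y + r) = (2 * ((r - 1) / 4) - (4 * y - 1) + 2 * k) * (2 * (1 - 4 * y))"
        if "k * (2 * (1 - 4 * y)) = - (12 * y\<^sup>2 - 5 * y + 1 - y * r)" for k r
      proof -
        have "2 * ((r - 1) / 4) = 1 / 2 * (r - 1)" by simp
        with that show ?thesis by algebra
      qed
      from this[OF exponent_drift_times[of y]] show ?thesis .
    qed
  qed (intro continuous_intros isCont_short_freq, simp, use d in simp)
  have m3: "extended_at_quarter (\<lambda>p. p * (-3 + 4 * p + sqrt (5 - 8 * p + 16 * p\<^sup>2)) / (-1 + 4 * p)) p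
      = (4 * p - 1) - 2 * ?k p"
    unfolding *
  proof (rule extended_at_quarter_eq)
    show "y * (-3 + 4 * y + ?r y) = ((4 * y - 1) - 2 * ?k y) * (-1 + 4 * y)" for y
    proof -
      have "y * (-3 + 4 * y + r) = ((4 * y - 1) - 2 * k) * (-1 + 4 * y)"
        if "k * (2 * (1 - 4 * y)) = - (12 * y\<^sup>2 - 5 * y + 1 - y * r)" for k r
        using that by algebra
      from this[OF exponent_drift_times[of y]] show ?thesis .
    qed
  qed (intro continuous_intros isCont_short_freq, use d in simp)
  have T: "real (garside_length_T g) = linear_fun 1 0 0 (nf g)" for g
    by (cases "nf g") (simp add: garside_length_T_eq)
  have P: "real (garside_length_pos g) = linear_fun 0 (- 3) 1 (nf g)" for g
    by (cases "nf g") (simp add: garside_length_pos_eq)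
  have E: "real_of_int (garside_exponent g) = linear_fun 0 1 0 (nf g)" for g
    by (cases "nf g") (simp add: garside_exponent_eq)
  show ?thesis
    unfolding pos ex m2 m3
  proof (intro conjI)
    show "has_drift M x (\<lambda>g. real (garside_length_T g)) ((-1 + ?r p) / 4)"
      by (rule has_drift_linear_fun_eq[OF T]) simp
    show "has_drift M x (\<lambda>g. real (garside_length_pos g)) (4 * p - 1 - 3 * ?k p)"
      by (rule has_drift_linear_fun_eq[OF P]) simp
    show "has_drift M x (\<lambda>g. real_of_int (garside_exponent g)) (?k p)"
      by (rule has_drift_linear_fun_eq[OF E]) simp
    have "1 - 4 * p = - (4 * p - 1)" "-1 + 4 * p = 4 * p - 1" by simp_all
    then show "has_drift M x (\<lambda>g. real (word_length g))
        (Max {1 - 4 * p, 2 * ((?r p - 1) / 4) - (4 * p - 1) + 2 * ?k p, 4 * p - 1 - 2 * ?k p, -1 + 4 * p})"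
      using has_drift_word_length by (simp only:)
  qed
qed

end
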